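(* For every $G$-space $X$, $$\mathrm{cat}^{G,\infty}(X)\le\mathrm{TC}^{G,\infty}(X)\le\mathrm{cat}^{G\times G,\infty}(X\times X)\le 2\,\mathrm{cat}^{G,\infty}(X),$$ where $X\times X$ carries the product $G\times G$-action.
   Context: All spaces are well-pointed CW complexes, $G$ a topological group acting cellularly; $x_0\in X$ is the base point. $PX$ is the path space with compact-open topology. $\mathcal{P}_k(X)=\{(\gamma_1,\dots,\gamma_k)\in(PX)^k\mid G\gamma_i(1)=G\gamma_{i+1}(0),\ 1\le i\le k-1\}$, $\pi_k\colon\mathcal{P}_k(X)\to X\times X$, $\pi_k(\gamma_1,\dots,\gamma_k)=(\gamma_1(0),\gamma_k(1))$. The (reduced) sectional category $\mathrm{secat}(f)$ of $f\colon E\to B$ is the least $n\ge0$ such that $B$ has an open cover $U_0,\dots,U_n$ with maps $s_i\colon U_i\to E$, $f\circ s_i\simeq(U_i\hookrightarrow B)$. $\mathrm{TC}^{G,k}(X)=\mathrm{secat}(\pi_k)$ and $\mathrm{TC}^{G,\infty}(X)=\min_k\mathrm{TC}^{G,k}(X)$. $P^k_*(X)$ is the pullback of $\pi_k$ along $X\to X\times X$, $x\mapsto(x_0,x)$, i.e. $P^k_*(X)=\{(\gamma_1,\dots,\gamma_k)\in\mathcal{P}_k(X)\mid\gamma_1(0)=x_0\}$ with fibration $q_k(\gamma_1,\dots,\gamma_k)=\gamma_k(1)$. The $k$-effective LS category is $\mathrm{cat}^{G,k}(X)=\mathrm{secat}(q_k)$ and the effective LS category is $\mathrm{cat}^{G,\infty}(X)=\min_{k\ge1}\mathrm{cat}^{G,k}(X)$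 (note $\mathrm{cat}^{G,1}(X)=\mathrm{cat}(X)$, reduced). *)

theory Defs
  imports "HOL-Analysis.Analysis" "HOL-Algebra.Group_Action"
begin

definition secat :: "'e topology \<Rightarrow> 'b topology \<Rightarrow> ('e \<Rightarrow> 'b) \<Rightarrow> enat" where
  "secat E B f = Inf {enat n | n. \<exists>U s.
      (\<Union>i\<le>n. U i) = topspace B \<and>
      (\<forall>i\<le>n. openin B (U i) \<and>
               continuous_map (subtopology B (U i)) E (s i) \<and>
               homotopic_with (\<lambda>_. True) (subtopology B (U i)) B (f \<circ> s i) id)}"

definition compact_open_paths :: "'a topology \<Rightarrow> (real \<Rightarrow> 'a) topology" where
  "compact_open_paths X = topology_generated_by
      {{\<gamma>. \<gamma> ` K \<subseteq> U} | K U. compact K \<and> K \<subseteq> {0..1} \<and> openin X U}"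

definition path_space :: "'a topology \<Rightarrow> (real \<Rightarrow> 'a) topology" where
  "path_space X = subtopology (compact_open_paths X)
      {\<gamma>. continuous_map (top_of_set {0..1}) X \<gamma> \<and> \<gamma> \<in> extensional {0..1}}"

definition orbit_of :: "('g, 'm) monoid_scheme \<Rightarrow> ('g \<Rightarrow> 'a \<Rightarrow> 'a) \<Rightarrow> 'a \<Rightarrow> 'a set" where
  "orbit_of G \<phi> x = {\<phi> g x | g. g \<in> carrier G}"

definition topological_group :: "('g, 'm) monoid_scheme \<Rightarrow> 'g topology \<Rightarrow> bool" where
  "topological_group G TG \<longleftrightarrow> group G \<and> topspace TG = carrier G \<and>
     continuous_map (prod_topology TG TG) TG (\<lambda>(g, h). g \<otimes>\<^bsub>G\<^esub> h) \<and>
     continuous_map TG TG (\<lambda>g. inv\<^bsub>G\<^esub> g)"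

definition G_space :: "('g, 'm) monoid_scheme \<Rightarrow> 'g topology \<Rightarrow> ('g \<Rightarrow> 'a \<Rightarrow> 'a) \<Rightarrow> 'a topology \<Rightarrow> bool" where
  "G_space G TG \<phi> X \<longleftrightarrow> topological_group G TG \<and> group_action G (topspace X) \<phi> \<and>
     continuous_map (prod_topology TG X) X (\<lambda>(g, x). \<phi> g x)"

definition prod_action :: "('g \<Rightarrow> 'a \<Rightarrow> 'a) \<Rightarrow> ('g \<times> 'g) \<Rightarrow> ('a \<times> 'a) \<Rightarrow> ('a \<times> 'a)" where
  "prod_action \<phi> = (\<lambda>(g, h) (x, y). (\<phi> g x, \<phi> h y))"

definition Pk :: "('g, 'm) monoid_scheme \<Rightarrow> ('g \<Rightarrow> 'a \<Rightarrow> 'a) \<Rightarrow> 'a topology \<Rightarrow> nat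
                    \<Rightarrow> (nat \<Rightarrow> real \<Rightarrow> 'a) topology" where
  "Pk G \<phi> X k = subtopology (product_topology (\<lambda>_. path_space X) {1..k})
      {\<Gamma>. \<forall>i. 1 \<le> i \<and> i \<le> k - 1 \<longrightarrow> orbit_of G \<phi> (\<Gamma> i 1) = orbit_of G \<phi> (\<Gamma> (i + 1) 0)}"

definition pi_k :: "nat \<Rightarrow> (nat \<Rightarrow> real \<Rightarrow> 'a) \<Rightarrow> 'a \<times> 'a" where
  "pi_k k \<Gamma> = (\<Gamma> 1 0, \<Gamma> k 1)"

definition TC_k :: "('g, 'm) monoid_scheme \<Rightarrow> ('g \<Rightarrow> 'a \<Rightarrow> 'a) \<Rightarrow> 'a topology \<Rightarrow> nat \<Rightarrow> enat" where
  "TC_k G \<phi> X k = secat (Pk G \<phi> X k) (prod_topology X X) (pi_k k)"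

definition TC_inf :: "('g, 'm) monoid_scheme \<Rightarrow> ('g \<Rightarrow> 'a \<Rightarrow> 'a) \<Rightarrow> 'a topology \<Rightarrow> enat" where
  "TC_inf G \<phi> X = (INF k\<in>{1..}. TC_k G \<phi> X k)"

definition Pk_star :: "('g, 'm) monoid_scheme \<Rightarrow> ('g \<Rightarrow> 'a \<Rightarrow> 'a) \<Rightarrow> 'a topology \<Rightarrow> 'a \<Rightarrow> nat
                    \<Rightarrow> (nat \<Rightarrow> real \<Rightarrow> 'a) topology" where
  "Pk_star G \<phi> X x0 k = subtopology (Pk G \<phi> X k) {\<Gamma>. \<Gamma> 1 0 = x0}"

definition q_k :: "nat \<Rightarrow> (nat \<Rightarrow> real \<Rightarrow> 'a) \<Rightarrow> 'a" where
  "q_k k \<Gamma> = \<Gamma> k 1"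

definition cat_k :: "('g, 'm) monoid_scheme \<Rightarrow> ('g \<Rightarrow> 'a \<Rightarrow> 'a) \<Rightarrow> 'a topology \<Rightarrow> 'a \<Rightarrow> nat \<Rightarrow> enat" where
  "cat_k G \<phi> X x0 k = secat (Pk_star G \<phi> X x0 k) X (q_k k)"

definition cat_inf :: "('g, 'm) monoid_scheme \<Rightarrow> ('g \<Rightarrow> 'a \<Rightarrow> 'a) \<Rightarrow> 'a topology \<Rightarrow> 'a \<Rightarrow> enat" where
  "cat_inf G \<phi> X x0 = (INF k\<in>{1..}. cat_k G \<phi> X x0 k)"

text \<open>Discs and spheres of dimension n, realised inside nat => real (product topology,
  which agrees with the Euclidean topology on the n-dimensional coordinate subspace).\<close>

definition closed_disc :: "nat \<Rightarrow> (nat \<Rightarrow> real) set" where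
  "closed_disc n = {x. (\<forall>i\<ge>n. x i = 0) \<and> (\<Sum>i<n. (x i)\<^sup>2) \<le> 1}"

definition open_disc :: "nat \<Rightarrow> (nat \<Rightarrow> real) set" where
  "open_disc n = {x. (\<forall>i\<ge>n. x i = 0) \<and> (\<Sum>i<n. (x i)\<^sup>2) < 1}"

definition disc_boundary :: "nat \<Rightarrow> (nat \<Rightarrow> real) set" where
  "disc_boundary n = {x. (\<forall>i\<ge>n. x i = 0) \<and> (\<Sum>i<n. (x i)\<^sup>2) = 1}"

definition CW_structure :: "'a topology \<Rightarrow> ((nat \<Rightarrow> real) \<Rightarrow> 'a) set \<Rightarrow> (((nat \<Rightarrow> real) \<Rightarrow> 'a) \<Rightarrow> nat) \<Rightarrow> bool" where
  "CW_structure X C d \<longleftrightarrow>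
     Hausdorff_space X \<and>
     (\<forall>\<Phi>\<in>C. continuous_map (top_of_set (closed_disc (d \<Phi>))) X \<Phi>) \<and>
     (\<forall>\<Phi>\<in>C. homeomorphic_map (top_of_set (open_disc (d \<Phi>)))
                  (subtopology X (\<Phi> ` open_disc (d \<Phi>))) \<Phi>) \<and>
     (\<forall>\<Phi>\<in>C. \<forall>\<Psi>\<in>C. \<Phi> \<noteq> \<Psi> \<longrightarrow> \<Phi> ` open_disc (d \<Phi>) \<inter> \<Psi> ` open_disc (d \<Psi>) = {}) \<and>
     (\<Union>\<Phi>\<in>C. \<Phi> ` open_disc (d \<Phi>)) = topspace X \<and>
     (\<forall>\<Phi>\<in>C. \<Phi> ` disc_boundary (d \<Phi>) \<subseteq> (\<Union>\<Psi>\<in>{\<Psi>\<in>C. d \<Psi> < d \<Phi>}. \<Psi> ` open_disc (d \<Psi>))) \<and>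
     (\<forall>\<Phi>\<in>C. finite {\<Psi>\<in>C. \<Psi> ` open_disc (d \<Psi>) \<inter> \<Phi> ` closed_disc (d \<Phi>) \<noteq> {}}) \<and>
     (\<forall>A. A \<subseteq> topspace X \<longrightarrow>
        (closedin X A \<longleftrightarrow>
         (\<forall>\<Phi>\<in>C. closedin (top_of_set (closed_disc (d \<Phi>))) (closed_disc (d \<Phi>) \<inter> \<Phi> -` A))))"

definition skeleton :: "((nat \<Rightarrow> real) \<Rightarrow> 'a) set \<Rightarrow> (((nat \<Rightarrow> real) \<Rightarrow> 'a) \<Rightarrow> nat) \<Rightarrow> nat \<Rightarrow> 'a set" where
  "skeleton C d n = (\<Union>\<Phi>\<in>{\<Phi>\<in>C. d \<Phi> \<le> n}. \<Phi> ` open_disc (d \<Phi>))"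

definition cellular_G_CW_complex ::
  "('g, 'm) monoid_scheme \<Rightarrow> ('g \<Rightarrow> 'a \<Rightarrow> 'a) \<Rightarrow> 'a topology \<Rightarrow> bool" where
  "cellular_G_CW_complex G \<phi> X \<longleftrightarrow> (\<exists>C d. CW_structure X C d \<and>
      (\<forall>g\<in>carrier G. \<forall>n. \<phi> g ` skeleton C d n \<subseteq> skeleton C d n))"

end

(*
  From TC to cat, restrict a section over U to the slice {x0} x X and prepend a path supplied by
  the homotopy. From cat of X x X to TC, reverse the first components of the given paths and join
  them at x0 to the second components.

  For the product inequality, let f_0, ..., f_n be nonnegative functions with f_i > 0 only on U_i
  and no common zero. For a point (x, y) consider the 2n+2 numbers f_i(x), f_j(y) and, for a set R
  of indices meeting both halves, the open set where every number in R is positive and exceeds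
  every number outside R. Such sets with equal card R are disjoint, each lies in some U_i x U_j,
  and taking as threshold a positive min(f_i(x), f_j(y)) shows that they cover; card R takes 2n+1
  values. The functions exist since a CW complex is normal: Urysohn functions are extended cell by
  cell with Tietze's theorem on the closed discs.
*)
theory Submission
  imports Defs
begin

section \<open>Continuity in path spaces\<close>

text \<open>There are (n+1)^2 products \<open>U i \<times> U j\<close>, and merging several of them
  into one member of a cover requires disjoint sets. Ranking the weights of both coordinates in one
  common list provides this, because two different top segments of one ranking cannot have equal
  size. A set of indices meeting both halves has at least 2 of the 2n+2 elements, which leaves 2n+1
  sizes and hence the reduced bound 2n. All weights are functions on X pulled back along the two
  projections, so openness is always meant in the product topology, which can be coarser than the
  cell topology of a product of CW complexes. Paths are never concatenated, only reversed: two paths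
  with a common end point become neighbours in a broken path, because equal points have equal
  orbits. The price is a longer broken path, k+1 or 2k instead of k, so the first two inequalities
  appear only after minimising over k, whereas the product inequality holds for each k.\<close>

abbreviation unit_interval :: "real topology" where
  "unit_interval \<equiv> top_of_set {0..1}"

text \<open>The subbasic set belonging to \<open>K = {}\<close> imposes no condition.\<close>

lemma topspace_compact_open_paths [simp]: "topspace (compact_open_paths X) = UNIV"
proof -
  have "\<exists>K U. UNIV = {\<gamma>::real \<Rightarrow> 'a. \<gamma> ` K \<subseteq> U} \<and> compact K \<and> K \<subseteq> {0..1} \<and> openin X U"
    by (intro exI[of _ "{}"]) auto
  then show ?thesis
    unfolding compact_open_paths_def topology_generated_by_topspace by blast
qed

lemma topspace_path_space:
  "topspace (path_space X) = {\<gamma>. continuous_map unit_interval X \<gamma> \<and> \<gamma> \<in> extensional {0..1}}"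
  by (simp add: path_space_def)

text \<open>One half of the exponential law, by the tube lemma: if \<open>{z} \<times> K\<close>
  lies in an open set and \<open>K\<close> is compact, so does \<open>A \<times> K\<close> for some
  neighbourhood \<open>A\<close> of \<open>z\<close>. The restriction to \<open>{0..1}\<close> makes
  the paths extensional.\<close>

lemma continuous_map_curry_path_space:
  fixes X :: "'a topology"
  assumes h: "continuous_map (prod_topology Z unit_interval) X h"
  shows "continuous_map Z (path_space X) (\<lambda>z. \<lambda>t\<in>{0..1}. h (z, t))"
  unfolding path_space_def continuous_map_in_subtopology
proof (intro conjI funcsetI)
  let ?c = "\<lambda>z. \<lambda>t\<in>{0..1}. h (z, t)"
  show "continuous_map Z (compact_open_paths X) ?c"
    unfolding compact_open_paths_def continuous_on_generated_topo_iff
  proof (intro conjI allI impI)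
    fix V :: "(real \<Rightarrow> 'a) set"
    assume "V \<in> {{\<gamma>. \<gamma> ` K \<subseteq> U} |K U. compact K \<and> K \<subseteq> {0..1} \<and> openin X U}"
    then obtain K :: "real set" and U where V: "V = {\<gamma>. \<gamma> ` K \<subseteq> U}" and K: "compact K" "K \<subseteq> {0..1}" and U: "openin X U"
      by blast
    define W where "W = {p \<in> topspace (prod_topology Z unit_interval). h p \<in> U}"
    have W: "openin (prod_topology Z unit_interval) W"
      unfolding W_def by (rule openin_continuous_map_preimage[OF h U])
    have Kc: "compactin unit_interval K"
      using K by (simp add: compactin_subtopology)
    have "?c z ` K = (\<lambda>t. h (z, t)) ` K" for z
      using K(2) by (intro image_cong) auto
    then have eq: "?c -` V \<inter> topspace Z = {z \<in> topspace Z. {z} \<times> K \<subseteq> W}"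
      using K(2) by (auto simp: V W_def)
    show "openin Z (?c -` V \<inter> topspace Z)"
      unfolding eq
    proof (subst openin_subopen, clarify)
      fix z assume z: "z \<in> topspace Z" "{z} \<times> K \<subseteq> W"
      then obtain A B where "openin Z A" "z \<in> A" "K \<subseteq> B" "A \<times> B \<subseteq> W"
        using tube_lemma_right[OF W Kc] by metis
      then show "\<exists>T. openin Z T \<and> z \<in> T \<and> T \<subseteq> {z \<in> topspace Z. {z} \<times> K \<subseteq> W}"
        using openin_subset by (intro exI[of _ A]) blast
    qed
  next
    show "?c ` topspace Z \<subseteq> \<Union> {{\<gamma>. \<gamma> ` K \<subseteq> U} |K U. compact K \<and> K \<subseteq> {0..1} \<and> openin X U}"
      using topspace_compact_open_paths[of X]
      unfolding compact_open_paths_def topology_generated_by_topspace by simp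
  qed
  show "?c z \<in> {\<gamma>. continuous_map unit_interval X \<gamma> \<and> \<gamma> \<in> extensional {0..1}}"
    if "z \<in> topspace Z" for z
  proof -
    have "continuous_map unit_interval X (h \<circ> (\<lambda>t. (z, t)))"
      by (rule continuous_map_compose[OF _ h]) (use that in \<open>simp add: continuous_map_pairwise o_def\<close>)
    then have "continuous_map unit_interval X (?c z)"
      by (rule continuous_map_eq) auto
    then show ?thesis by simp
  qed
qed

text \<open>The other half of the exponential law, resting on local compactness of the interval: a
  compact neighbourhood of \<open>t\<close> that \<open>\<gamma>\<close> maps into \<open>U\<close>
  defines a subbasic neighbourhood of \<open>\<gamma>\<close>.\<close>

lemma continuous_map_eval_path_space:
  "continuous_map (prod_topology (path_space X) unit_interval) X (\<lambda>(\<gamma>, t). \<gamma> t)"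
  unfolding continuous_map_def
proof (intro conjI allI impI funcsetI)
  fix p assume "p \<in> topspace (prod_topology (path_space X) unit_interval)"
  then show "(case p of (\<gamma>, t) \<Rightarrow> \<gamma> t) \<in> topspace X"
    by (auto simp: topspace_path_space continuous_map_def)
next
  fix U assume U: "openin X U"
  let ?P = "{p \<in> topspace (prod_topology (path_space X) unit_interval). (case p of (\<gamma>, t) \<Rightarrow> \<gamma> t) \<in> U}"
  show "openin (prod_topology (path_space X) unit_interval) ?P"
  proof (subst openin_subopen, clarify)
    fix \<gamma> :: "real \<Rightarrow> 'a" and t :: real
    assume "(\<gamma>, t) \<in> topspace (prod_topology (path_space X) unit_interval)" and tU: "\<gamma> t \<in> U"
    then have \<gamma>: "\<gamma> \<in> topspace (path_space X)" "continuous_map unit_interval X \<gamma>" and t: "t \<in> {0..1}"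
      by (auto simp: topspace_path_space)
    have "openin unit_interval {s \<in> {0..1}. \<gamma> s \<in> U}"
      using openin_continuous_map_preimage[OF \<gamma>(2) U] by simp
    then obtain e where e: "e > 0" "\<And>s. s \<in> {0..1} \<Longrightarrow> dist s t < e \<Longrightarrow> \<gamma> s \<in> U"
      using t tU unfolding openin_euclidean_subtopology_iff by blast
    \<comment> \<open>Half the radius keeps the closed ball inside the \<open>e\<close>-ball on
      which \<open>\<gamma>\<close> stays in \<open>U\<close>.\<close>
    define K where "K = cball t (e/2) \<inter> {0..1}"
    define V where "V = topspace (path_space X) \<inter> {\<gamma>. \<gamma> ` K \<subseteq> U}"
    have "compact K" "K \<subseteq> {0..1}" by (auto simp: K_def)
    then have "openin (compact_open_paths X) {\<gamma>. \<gamma> ` K \<subseteq> U}"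
      unfolding compact_open_paths_def using U by (intro topology_generated_by_Basis) blast
    then have "openin (path_space X) V"
      unfolding V_def path_space_def topspace_subtopology openin_subtopology by auto
    moreover have "openin unit_interval (ball t (e/2) \<inter> {0..1})"
      by (metis Int_commute openin_open_Int open_ball)
    moreover have "(\<gamma>, t) \<in> V \<times> (ball t (e/2) \<inter> {0..1})"
      using e t \<gamma> by (auto simp: V_def K_def dist_commute)
    moreover have "V \<times> (ball t (e/2) \<inter> {0..1}) \<subseteq> ?P"
      by (auto simp: V_def K_def image_subset_iff)
    ultimately show "\<exists>T. openin (prod_topology (path_space X) unit_interval) T \<and> (\<gamma>, t) \<in> T \<and> T \<subseteq> ?P"
      by (intro exI[of _ "V \<times> (ball t (e/2) \<inter> {0..1})"] conjI) (auto simp: openin_prod_Times_iff)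
  qed
qed

section \<open>Maps into and out of spaces of broken paths\<close>

lemma Pk_orbits_match:
  assumes "\<Gamma> \<in> topspace (Pk G \<phi> X k)" "1 \<le> i" "i < k"
  shows "orbit_of G \<phi> (\<Gamma> i 1) = orbit_of G \<phi> (\<Gamma> (i + 1) 0)"
  using assms by (auto simp: Pk_def)

text \<open>By the exponential law a continuous family of broken paths amounts to \<open>k\<close>
  maps on \<open>Z \<times> [0,1]\<close> whose ends match. All later sections are built in this way
  and taken apart by \<open>continuous_map_Pk_component\<close>.\<close>

lemma continuous_map_into_Pk:
  assumes h: "\<And>i. i \<in> {1..k} \<Longrightarrow> continuous_map (prod_topology Z unit_interval) X (h i)"
    and orb: "\<And>z i. z \<in> topspace Z \<Longrightarrow> 1 \<le> i \<Longrightarrow> i < k \<Longrightarrow>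
               orbit_of G \<phi> (h i (z, 1)) = orbit_of G \<phi> (h (i + 1) (z, 0))"
  shows "continuous_map Z (Pk G \<phi> X k) (\<lambda>z. \<lambda>i\<in>{1..k}. \<lambda>t\<in>{0..1}. h i (z, t))"
  unfolding Pk_def continuous_map_in_subtopology continuous_map_componentwise
proof (intro conjI ballI subsetI funcsetI)
  fix i assume "i \<in> {1..k}"
  then show "continuous_map Z (path_space X) (\<lambda>z. (\<lambda>i\<in>{1..k}. \<lambda>t\<in>{0..1}. h i (z, t)) i)"
    using continuous_map_curry_path_space[OF h] by simp
next
  fix z assume z: "z \<in> topspace Z"
  have "orbit_of G \<phi> (h i (z, 1)) = orbit_of G \<phi> (h (i + 1) (z, 0))" if "1 \<le> i" "i \<le> k - 1" for i
    using orb[OF z] that by simp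
  then show "(\<lambda>i\<in>{1..k}. \<lambda>t\<in>{0..1}. h i (z, t)) \<in> {\<Gamma>. \<forall>i. 1 \<le> i \<and> i \<le> k - 1 \<longrightarrow>
          orbit_of G \<phi> (\<Gamma> i 1) = orbit_of G \<phi> (\<Gamma> (i + 1) 0)}"
    by auto
qed auto

lemma continuous_map_Pk_component:
  assumes s: "continuous_map Z (Pk G \<phi> X k) s" and i: "i \<in> {1..k}"
  shows "continuous_map (prod_topology Z unit_interval) X (\<lambda>(z, t). s z i t)"
proof -
  have si: "continuous_map Z (path_space X) (\<lambda>z. s z i)"
    using s i unfolding Pk_def continuous_map_in_subtopology continuous_map_componentwise by blast
  have "continuous_map (prod_topology Z unit_interval) X ((\<lambda>(\<gamma>, t). \<gamma> t) \<circ> (\<lambda>(z, t). (s z i, t)))"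
    by (rule continuous_map_compose[OF _ continuous_map_eval_path_space])
       (auto simp: continuous_map_prod_top si)
  then show ?thesis by (simp add: o_def case_prod_unfold)
qed

lemma continuous_map_into_Pk_star:
  assumes "\<And>i. i \<in> {1..k} \<Longrightarrow> continuous_map (prod_topology Z unit_interval) X (h i)"
    and "\<And>z i. z \<in> topspace Z \<Longrightarrow> 1 \<le> i \<Longrightarrow> i < k \<Longrightarrow>
               orbit_of G \<phi> (h i (z, 1)) = orbit_of G \<phi> (h (i + 1) (z, 0))"
    and "1 \<le> k" "\<And>z. z \<in> topspace Z \<Longrightarrow> h 1 (z, 0) = x0"
  shows "continuous_map Z (Pk_star G \<phi> X x0 k) (\<lambda>z. \<lambda>i\<in>{1..k}. \<lambda>t\<in>{0..1}. h i (z, t))"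
  unfolding Pk_star_def continuous_map_in_subtopology
  using continuous_map_into_Pk[of k Z X h G \<phi>] assms by auto

lemma continuous_map_Pk_starD:
  assumes "continuous_map Z (Pk_star G \<phi> X x0 k) s"
  shows "continuous_map Z (Pk G \<phi> X k) s" "\<And>z. z \<in> topspace Z \<Longrightarrow> s z 1 0 = x0"
  using assms by (auto simp: Pk_star_def continuous_map_in_subtopology)

section \<open>Sectional category\<close>

text \<open>Isolates the condition on a single member of the cover in \<open>secat\<close>, so that
  covers can be changed set by set.\<close>

definition sectional_set :: "'e topology \<Rightarrow> 'b topology \<Rightarrow> ('e \<Rightarrow> 'b) \<Rightarrow> 'b set \<Rightarrow> bool" where
  "sectional_set E B f U \<longleftrightarrow> openin B U \<and>
     (\<exists>s. continuous_map (subtopology B U) E s \<and>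
          homotopic_with (\<lambda>_. True) (subtopology B U) B (f \<circ> s) id)"

text \<open>Later constructions use the homotopy itself as a family of paths, so it is made
  explicit, with its direction: \<open>f \<circ> s\<close> at time 0, the inclusion at time
  1.\<close>

lemma sectional_set_iff:
  "sectional_set E B f U \<longleftrightarrow> openin B U \<and>
     (\<exists>s h. continuous_map (subtopology B U) E s \<and>
          continuous_map (prod_topology unit_interval (subtopology B U)) B h \<and>
          (\<forall>x\<in>U. h (0, x) = f (s x)) \<and> (\<forall>x\<in>U. h (1, x) = x))"
proof -
  have "topspace (subtopology B U) = U" if "openin B U"
    using openin_subset[OF that] by auto
  then show ?thesis
    unfolding sectional_set_def using homotopic_with[where P = "\<lambda>_. True" and X = "subtopology B U" and Y = B]
    by (simp del: topspace_subtopology) blast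
qed

lemma secat_eq:
  "secat E B f = Inf {enat n | n. \<exists>U. (\<Union>i\<le>n. U i) = topspace B \<and> (\<forall>i\<le>n. sectional_set E B f (U i))}"
proof -
  have "(\<exists>U s. (\<Union>i\<le>n. U i) = topspace B \<and>
      (\<forall>i\<le>n. openin B (U i) \<and> continuous_map (subtopology B (U i)) E (s i) \<and>
               homotopic_with (\<lambda>_. True) (subtopology B (U i)) B (f \<circ> s i) id)) \<longleftrightarrow>
     (\<exists>U. (\<Union>i\<le>n. U i) = topspace B \<and> (\<forall>i\<le>n. sectional_set E B f (U i)))" for n :: nat
    unfolding sectional_set_def by (intro iff_exI) (metis (no_types, lifting))
  then show ?thesis unfolding secat_def by simp
qed

lemma secat_le:
  assumes "(\<Union>i\<le>n. U i) = topspace B" "\<And>i. i \<le> n \<Longrightarrow> sectional_set E B f (U i)"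
  shows "secat E B f \<le> enat n"
  unfolding secat_eq using assms by (intro Inf_lower) blast

text \<open>\<open>enat\<close> is well-ordered, so infima are attained: this yields a cover of
  optimal size and, at the end, an optimal \<open>k\<close>.\<close>

lemma enat_Inf_in: "S \<noteq> {} \<Longrightarrow> Inf S \<in> (S :: enat set)"
  by (metis Inf_enat_def LeastI ex_in_conv)

lemma secat_enatE:
  assumes "secat E B f = enat n"
  obtains U where "(\<Union>i\<le>n. U i) = topspace B" "\<And>i. i \<le> n \<Longrightarrow> sectional_set E B f (U i)"
proof -
  define S where "S = {enat n | n. \<exists>U. (\<Union>i\<le>n. U i) = topspace B \<and> (\<forall>i\<le>n. sectional_set E B f (U i))}"
  have eq: "Inf S = enat n" using assms unfolding secat_eq S_def .
  then have "S \<noteq> {}" by (auto simp: Inf_enat_def)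
  then have "Inf S \<in> S" by (rule enat_Inf_in)
  then have "enat n \<in> S" by (simp add: eq)
  then show ?thesis using that by (auto simp: S_def)
qed

lemma secat_leI:
  assumes "\<And>n U. (\<Union>i\<le>n. U i) = topspace B' \<Longrightarrow> (\<And>i. i \<le> n \<Longrightarrow> sectional_set E' B' f' (U i)) \<Longrightarrow>
             secat E B f \<le> enat n"
  shows "secat E B f \<le> secat E' B' f'"
proof (cases "secat E' B' f'")
  case (enat n)
  then show ?thesis using assms by (metis secat_enatE)
qed simp

lemma sectional_set_subset:
  assumes "sectional_set E B f U" "openin B V" "V \<subseteq> U"
  shows "sectional_set E B f V"
proof -
  obtain s h where s: "continuous_map (subtopology B U) E s"
    and h: "continuous_map (prod_topology unit_interval (subtopology B U)) B h"
    and hs: "\<forall>x\<in>U. h (0, x) = f (s x)" "\<forall>x\<in>U. h (1, x) = x"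
    using assms(1) unfolding sectional_set_iff by blast
  have sub: "subtopology B V = subtopology (subtopology B U) V"
    using assms(3) by (simp add: subtopology_subtopology inf.absorb2)
  have "continuous_map (subtopology B V) E s"
    unfolding sub by (rule continuous_map_from_subtopology[OF s])
  moreover have "continuous_map (prod_topology unit_interval (subtopology B V)) B h"
    unfolding sub prod_topology_subtopology(2)[of unit_interval "subtopology B U"]
    by (rule continuous_map_from_subtopology[OF h])
  ultimately show ?thesis
    using assms(2,3) hs unfolding sectional_set_iff by blast
qed

text \<open>Without overlaps there is no compatibility to check, so sections and homotopies paste
  over the open pieces. Arbitrarily many disjoint sets thus count as one member of a cover.\<close>

lemma sectional_set_disjoint_Union:
  assumes "\<And>i. i \<in> I \<Longrightarrow> sectional_set E B f (V i)"
    and disj: "\<And>i j. i \<in> I \<Longrightarrow> j \<in> I \<Longrightarrow> i \<noteq> j \<Longrightarrow> V i \<inter> V j = {}"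
  shows "sectional_set E B f (\<Union>i\<in>I. V i)"
proof -
  define W where "W = (\<Union>i\<in>I. V i)"
  have op: "\<And>i. i \<in> I \<Longrightarrow> openin B (V i)"
    using assms(1) by (simp add: sectional_set_def)
  then have oW: "openin B W" unfolding W_def by blast
  have opW: "openin (subtopology B W) (V i)" if "i \<in> I" for i
    using that op by (simp add: openin_open_subtopology oW) (auto simp: W_def)
  have sub: "subtopology (subtopology B W) (V i) = subtopology B (V i)" if "i \<in> I" for i
    using that by (simp add: subtopology_subtopology W_def inf.absorb2 UN_upper)
  have "\<forall>i\<in>I. \<exists>s h. continuous_map (subtopology B (V i)) E s \<and>
          continuous_map (prod_topology unit_interval (subtopology B (V i))) B h \<and>
          (\<forall>x\<in>V i. h (0, x) = f (s x)) \<and> (\<forall>x\<in>V i. h (1, x) = x)"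
    using assms(1) unfolding sectional_set_iff by blast
  then obtain s h where s: "\<And>i. i \<in> I \<Longrightarrow> continuous_map (subtopology B (V i)) E (s i)"
    and h: "\<And>i. i \<in> I \<Longrightarrow> continuous_map (prod_topology unit_interval (subtopology B (V i))) B (h i)"
    and h0: "\<And>i x. i \<in> I \<Longrightarrow> x \<in> V i \<Longrightarrow> h i (0, x) = f (s i x)"
    and h1: "\<And>i x. i \<in> I \<Longrightarrow> x \<in> V i \<Longrightarrow> h i (1, x) = x"
    by metis
  \<comment> \<open>Disjointness makes this index unique, so the glued maps agree with the
    \<open>i\<close>-th ones on all of \<open>V i\<close>.\<close>
  define idx where "idx x = (SOME i. i \<in> I \<and> x \<in> V i)" for x
  have idx: "idx x = i" if "i \<in> I" "x \<in> V i" for x i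
    unfolding idx_def using that disj by (intro some_equality) auto
  have tW: "topspace (subtopology B W) = W"
    using openin_subset[OF oW] by auto
  have 1: "continuous_map (subtopology B W) E (\<lambda>x. s (idx x) x)"
  proof (rule pasting_lemma[where I = I and T = V and f = s])
    show "continuous_map (subtopology (subtopology B W) (V i)) E (s i)" if "i \<in> I" for i
      using s sub that by simp
    show "s i x = s j x" if "i \<in> I" "j \<in> I" "x \<in> topspace (subtopology B W) \<inter> V i \<inter> V j" for i j x
      using disj that by blast
    show "\<exists>j. j \<in> I \<and> x \<in> V j \<and> s (idx x) x = s j x" if "x \<in> topspace (subtopology B W)" for x
      using that unfolding tW by (auto simp: W_def idx)
  qed (fact opW)
  have 2: "continuous_map (prod_topology unit_interval (subtopology B W)) B (\<lambda>(t, x). h (idx x) (t, x))"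
  proof (rule pasting_lemma[where I = I and T = "\<lambda>i. {0..1} \<times> V i" and f = h])
    show "openin (prod_topology unit_interval (subtopology B W)) ({0..1} \<times> V i)" if "i \<in> I" for i
      using opW[OF that] by (simp add: openin_prod_Times_iff)
    show "continuous_map (subtopology (prod_topology unit_interval (subtopology B W)) ({0..1} \<times> V i)) B (h i)"
      if "i \<in> I" for i
    proof -
      have "subtopology (prod_topology unit_interval (subtopology B W)) ({0..1} \<times> V i) =
          prod_topology unit_interval (subtopology B (V i))"
        unfolding subtopology_Times sub[OF that] by (simp add: subtopology_subtopology)
      then show ?thesis using h[OF that] by simp
    qed
    show "h i x = h j x" if "i \<in> I" "j \<in> I"
      "x \<in> topspace (prod_topology unit_interval (subtopology B W)) \<inter> ({0..1} \<times> V i) \<inter> ({0..1} \<times> V j)" for i j x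
      using disj that by blast
    show "\<exists>j. j \<in> I \<and> x \<in> {0..1} \<times> V j \<and> (\<lambda>(t, x). h (idx x) (t, x)) x = h j x"
      if "x \<in> topspace (prod_topology unit_interval (subtopology B W))" for x
      using that unfolding topspace_prod_topology tW by (auto simp: W_def idx)
  qed
  have "sectional_set E B f W"
    unfolding sectional_set_iff
    using oW 1 2 h0 h1 idx
    by (intro conjI exI[of _ "\<lambda>x. s (idx x) x"] exI[of _ "\<lambda>(t, x). h (idx x) (t, x)"]) (auto simp: W_def)
  then show ?thesis by (simp add: W_def)
qed

section \<open>Normality of CW complexes\<close>

lemma closed_disc_eq: "closed_disc n = open_disc n \<union> disc_boundary n"
  by (auto simp: closed_disc_def open_disc_def disc_boundary_def)

lemma disc_boundary_subset: "disc_boundary n \<subseteq> closed_disc n"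
  and open_disc_subset: "open_disc n \<subseteq> closed_disc n"
  by (auto simp: closed_disc_eq)

lemma disc_sets_closed: "closed (closed_disc n)" "closed (disc_boundary n)"
proof -
  have c: "continuous_on UNIV (\<lambda>x :: nat \<Rightarrow> real. x i)" for i
    by (rule continuous_on_product_coordinates)
  have 1: "closed (\<Inter>i\<in>{n..}. {x :: nat \<Rightarrow> real. x i = 0})"
    by (intro closed_INT ballI closed_Collect_eq c continuous_intros)
  have s: "continuous_on UNIV (\<lambda>x :: nat \<Rightarrow> real. \<Sum>i<n. (x i)\<^sup>2)"
    by (intro continuous_intros c)
  have "closed_disc n = (\<Inter>i\<in>{n..}. {x. x i = 0}) \<inter> {x. (\<Sum>i<n. (x i)\<^sup>2) \<le> 1}"
    "disc_boundary n = (\<Inter>i\<in>{n..}. {x. x i = 0}) \<inter> {x. (\<Sum>i<n. (x i)\<^sup>2) = 1}"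
    by (auto simp: closed_disc_def disc_boundary_def)
  then show "closed (closed_disc n)" "closed (disc_boundary n)"
    using 1 by (auto intro!: closed_Int closed_Collect_le closed_Collect_eq s continuous_intros)
qed

text \<open>The disc is a closed subset of the cube of sequences with entries in [-1,1], which is
  compact by Tychonoff.\<close>

lemma compact_closed_disc: "compact (closed_disc n)"
proof -
  have sub: "closed_disc n \<subseteq> PiE UNIV (\<lambda>_. {-1..1})"
  proof
    fix x assume x: "x \<in> closed_disc n"
    have "x i \<in> {-1..1}" for i
    proof (cases "i < n")
      case True
      then have "(x i)\<^sup>2 \<le> (\<Sum>i<n. (x i)\<^sup>2)"
        by (intro member_le_sum) auto
      then have "(x i)\<^sup>2 \<le> 1" using x by (simp add: closed_disc_def)
      then show ?thesis by (simp add: abs_square_le_1 abs_le_iff)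
    qed (use x in \<open>auto simp: closed_disc_def\<close>)
    then show "x \<in> PiE UNIV (\<lambda>_. {-1..1})" by auto
  qed
  have "compactin (product_topology (\<lambda>_. euclidean) UNIV) (PiE UNIV (\<lambda>_::nat. {-1..1::real}))"
    by (simp add: compactin_PiE)
  then have "compact (PiE UNIV (\<lambda>_::nat. {-1..1::real}))"
    by (simp add: euclidean_product_topology)
  then show ?thesis
    using compact_Int_closed[OF _ disc_sets_closed(1)] sub by (metis inf.absorb2)
qed

lemma normal_space_closed_disc: "normal_space (top_of_set (closed_disc n))"
  using compact_closed_disc
  by (intro compact_Hausdorff_or_regular_imp_normal_space disjI1 Hausdorff_space_subtopology)
     (auto simp: compact_space_subtopology)

lemma closedin_closed_disc_subset: "closedin (top_of_set (closed_disc n)) S \<longleftrightarrow> closed S \<and> S \<subseteq> closed_disc n"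
  using disc_sets_closed(1) by (simp add: closedin_closed_eq)

section \<open>Skeleta and Urysohn functions on a CW complex\<close>

locale cw_complex =
  fixes X :: "'a topology" and C :: "((nat \<Rightarrow> real) \<Rightarrow> 'a) set" and d :: "((nat \<Rightarrow> real) \<Rightarrow> 'a) \<Rightarrow> nat"
  assumes cw: "CW_structure X C d"
begin

abbreviation cell :: "((nat \<Rightarrow> real) \<Rightarrow> 'a) \<Rightarrow> 'a set" where
  "cell \<Phi> \<equiv> \<Phi> ` open_disc (d \<Phi>)"

abbreviation disc :: "((nat \<Rightarrow> real) \<Rightarrow> 'a) \<Rightarrow> (nat \<Rightarrow> real) set" where
  "disc \<Phi> \<equiv> closed_disc (d \<Phi>)"

text \<open>The skeleton of dimension n - 1. The strict inequality makes \<open>below 0\<close>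
  empty, so inductions start from nothing, and puts the boundary of the cell \<open>\<Phi>\<close>
  into \<open>below (d \<Phi>)\<close>.\<close>

definition below :: "nat \<Rightarrow> 'a set" where
  "below n = (\<Union>\<Phi>\<in>{\<Phi>\<in>C. d \<Phi> < n}. cell \<Phi>)"

lemma characteristic_continuous: "\<Phi> \<in> C \<Longrightarrow> continuous_map (top_of_set (disc \<Phi>)) X \<Phi>"
  and Hausdorff: "Hausdorff_space X"
  and cells_disjoint: "\<Phi> \<in> C \<Longrightarrow> \<Psi> \<in> C \<Longrightarrow> \<Phi> \<noteq> \<Psi> \<Longrightarrow> cell \<Phi> \<inter> cell \<Psi> = {}"
  and cells_cover: "(\<Union>\<Phi>\<in>C. cell \<Phi>) = topspace X"
  and boundary_below: "\<Phi> \<in> C \<Longrightarrow> \<Phi> ` disc_boundary (d \<Phi>) \<subseteq> below (d \<Phi>)"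
  and closure_finite: "\<Phi> \<in> C \<Longrightarrow> finite {\<Psi>\<in>C. cell \<Psi> \<inter> \<Phi> ` disc \<Phi> \<noteq> {}}"
  and weak_topology: "A \<subseteq> topspace X \<Longrightarrow>
        closedin X A \<longleftrightarrow> (\<forall>\<Phi>\<in>C. closedin (top_of_set (disc \<Phi>)) (disc \<Phi> \<inter> \<Phi> -` A))"
proof -
  note c = cw[unfolded CW_structure_def]
  note c2 = c[THEN conjunct2] note c3 = c2[THEN conjunct2] note c4 = c3[THEN conjunct2]
  note c5 = c4[THEN conjunct2] note c6 = c5[THEN conjunct2] note c7 = c6[THEN conjunct2]
  show "\<Phi> \<in> C \<Longrightarrow> continuous_map (top_of_set (disc \<Phi>)) X \<Phi>" by (rule bspec[OF c2[THEN conjunct1]])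
  show "Hausdorff_space X" by (rule c[THEN conjunct1])
  show "\<Phi> \<in> C \<Longrightarrow> \<Psi> \<in> C \<Longrightarrow> \<Phi> \<noteq> \<Psi> \<Longrightarrow> cell \<Phi> \<inter> cell \<Psi> = {}"
    using c4[THEN conjunct1] by simp
  show "(\<Union>\<Phi>\<in>C. cell \<Phi>) = topspace X" by (rule c5[THEN conjunct1])
  show "\<Phi> \<in> C \<Longrightarrow> \<Phi> ` disc_boundary (d \<Phi>) \<subseteq> below (d \<Phi>)"
    unfolding below_def by (rule bspec[OF c6[THEN conjunct1]])
  show "\<Phi> \<in> C \<Longrightarrow> finite {\<Psi>\<in>C. cell \<Psi> \<inter> \<Phi> ` disc \<Phi> \<noteq> {}}"
    by (rule bspec[OF c7[THEN conjunct1]])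
  show "A \<subseteq> topspace X \<Longrightarrow>
        closedin X A \<longleftrightarrow> (\<forall>\<Phi>\<in>C. closedin (top_of_set (disc \<Phi>)) (disc \<Phi> \<inter> \<Phi> -` A))"
    by (rule c7[THEN conjunct2, rule_format])
qed

lemma characteristic_inj: "\<Phi> \<in> C \<Longrightarrow> inj_on \<Phi> (open_disc (d \<Phi>))"
proof -
  assume "\<Phi> \<in> C"
  then have "homeomorphic_map (top_of_set (open_disc (d \<Phi>))) (subtopology X (cell \<Phi>)) \<Phi>"
    by (rule bspec[OF cw[unfolded CW_structure_def, THEN conjunct2, THEN conjunct2, THEN conjunct1]])
  then show ?thesis
    using homeomorphic_imp_injective_map by fastforce
qed

lemma below_subset_topspace: "below n \<subseteq> topspace X"
  using cells_cover by (auto simp: below_def)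

lemma below_mono: "m \<le> n \<Longrightarrow> below m \<subseteq> below n"
  by (auto simp: below_def)

lemma characteristic_image_below: "\<Phi> \<in> C \<Longrightarrow> d \<Phi> < n \<Longrightarrow> \<Phi> ` disc \<Phi> \<subseteq> below n"
  using boundary_below[of \<Phi>] below_mono[of "d \<Phi>" n]
  unfolding closed_disc_eq image_Un by (auto simp: below_def[of n])

lemma cell_not_below:
  assumes "\<Phi> \<in> C" "v \<in> open_disc (d \<Phi>)"
  shows "\<Phi> v \<notin> below (d \<Phi>)"
proof
  assume "\<Phi> v \<in> below (d \<Phi>)"
  then obtain \<Psi> where "\<Psi> \<in> C" "d \<Psi> < d \<Phi>" "\<Phi> v \<in> cell \<Psi>"
    by (auto simp: below_def)
  moreover from this have "\<Phi> \<noteq> \<Psi>" by auto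
  ultimately show False using cells_disjoint[of \<Phi> \<Psi>] assms by blast
qed

text \<open>The weak topology asks for a test on every disc; for a subset of a skeleton the discs of
  that skeleton suffice. This makes induction over skeleta possible, since nothing is known yet on
  higher cells.\<close>

lemma closedin_below:
  assumes K: "K \<subseteq> below n"
    and cl: "\<And>\<Psi>. \<Psi> \<in> C \<Longrightarrow> d \<Psi> < n \<Longrightarrow> closedin (top_of_set (disc \<Psi>)) (disc \<Psi> \<inter> \<Psi> -` K)"
  shows "closedin X K"
proof -
  have "closedin (top_of_set (disc \<Phi>)) (disc \<Phi> \<inter> \<Phi> -` K)" if \<Phi>: "\<Phi> \<in> C" for \<Phi>
  proof -
    \<comment> \<open>by closure finiteness, \<open>K\<close> can be replaced by a finite union of compact sets on the disc of \<open>\<Phi>\<close>\<close>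
    define F where "F = {\<Psi>\<in>C. d \<Psi> < n \<and> cell \<Psi> \<inter> \<Phi> ` disc \<Phi> \<noteq> {}}"
    define L where "L = (\<Union>\<Psi>\<in>F. \<Psi> ` (disc \<Psi> \<inter> \<Psi> -` K))"
    have "finite F"
      by (rule finite_subset[OF _ closure_finite[OF \<Phi>]]) (auto simp: F_def)
    moreover have "closedin X (\<Psi> ` (disc \<Psi> \<inter> \<Psi> -` K))" if "\<Psi> \<in> F" for \<Psi>
    proof -
      have "compact (disc \<Psi> \<inter> \<Psi> -` K)"
        using cl[of \<Psi>] that compact_closed_disc[of "d \<Psi>"]
        by (auto simp: F_def closedin_compact)
      then have "compactin (top_of_set (disc \<Psi>)) (disc \<Psi> \<inter> \<Psi> -` K)"
        by (auto simp: compactin_subtopology)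
      then have "compactin X (\<Psi> ` (disc \<Psi> \<inter> \<Psi> -` K))"
        using characteristic_continuous[of \<Psi>] that by (intro image_compactin) (auto simp: F_def)
      then show ?thesis by (rule compactin_imp_closedin[OF Hausdorff])
    qed
    ultimately have "closedin X L" unfolding L_def by (intro closedin_Union) auto
    then have "closedin (top_of_set (disc \<Phi>)) {v \<in> topspace (top_of_set (disc \<Phi>)). \<Phi> v \<in> L}"
      by (rule closedin_continuous_map_preimage[OF characteristic_continuous[OF \<Phi>]])
    moreover have "{v \<in> topspace (top_of_set (disc \<Phi>)). \<Phi> v \<in> L} = disc \<Phi> \<inter> \<Phi> -` K"
    proof -
      \<comment> \<open>A point of \<open>K\<close> lies in some open cell of dimension below
        \<open>n\<close>; that cell meets the image of the disc of \<open>\<Phi>\<close> in this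
        very point, so it was recorded in \<open>F\<close>.\<close>
      have "\<Phi> v \<in> L" if v: "v \<in> disc \<Phi>" "\<Phi> v \<in> K" for v
      proof -
        obtain \<Psi> w where \<Psi>: "\<Psi> \<in> C" "d \<Psi> < n" "w \<in> open_disc (d \<Psi>)" "\<Phi> v = \<Psi> w"
          using K v unfolding below_def by blast
        then have "\<Psi> \<in> F" using v unfolding F_def by blast
        moreover have "w \<in> disc \<Psi> \<inter> \<Psi> -` K"
          using \<Psi> v open_disc_subset by auto
        ultimately show ?thesis unfolding L_def \<Psi>(4) by blast
      qed
      then show ?thesis by (auto simp: L_def)
    qed
    ultimately show ?thesis by simp
  qed
  then show ?thesis
    using weak_topology K below_subset_topspace by blast
qed

text \<open>The function is total, but its values matter only on \<open>below n\<close>. Continuity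
  is stated through characteristic maps, the form in which it is extended and in which the weak
  topology tests it.\<close>

definition partial_Urysohn :: "'a set \<Rightarrow> 'a set \<Rightarrow> nat \<Rightarrow> ('a \<Rightarrow> real) \<Rightarrow> bool" where
  "partial_Urysohn A B n f \<longleftrightarrow>
     (\<forall>\<Phi>\<in>C. d \<Phi> < n \<longrightarrow> continuous_on (disc \<Phi>) (f \<circ> \<Phi>)) \<and>
     (\<forall>x\<in>below n. 0 \<le> f x \<and> f x \<le> 1 \<and> (x \<in> A \<longrightarrow> f x = 0) \<and> (x \<in> B \<longrightarrow> f x = 1))"

text \<open>Continuity on the skeleton in usable form: by \<open>closedin_below\<close> the
  preimages are closed in all of \<open>X\<close>, so characteristic maps of higher cells can pull
  them back.\<close>

lemma partial_Urysohn_closed_preimage: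
  assumes f: "partial_Urysohn A B n f" and T: "closed T"
  shows "closedin X {x \<in> below n. f x \<in> T}"
proof (rule closedin_below)
  fix \<Psi> assume \<Psi>: "\<Psi> \<in> C" "d \<Psi> < n"
  then have "continuous_on (disc \<Psi>) (f \<circ> \<Psi>)"
    using f by (simp add: partial_Urysohn_def)
  then have "closedin (top_of_set (disc \<Psi>)) (disc \<Psi> \<inter> (f \<circ> \<Psi>) -` T)"
    using T by (rule continuous_closedin_preimage)
  moreover have "disc \<Psi> \<inter> (f \<circ> \<Psi>) -` T = disc \<Psi> \<inter> \<Psi> -` {x \<in> below n. f x \<in> T}"
    using characteristic_image_below[OF \<Psi>] by auto
  ultimately show "closedin (top_of_set (disc \<Psi>)) (disc \<Psi> \<inter> \<Psi> -` {x \<in> below n. f x \<in> T})"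
    by simp
qed blast

text \<open>The values are forced on the boundary sphere and on the preimages of \<open>A\<close>
  and \<open>B\<close>. These sets are closed, so Tietze's theorem with target [0,1] fills in the
  rest of the disc.\<close>

lemma extend_over_disc:
  assumes f: "partial_Urysohn A B (d \<Phi>) f" and \<Phi>: "\<Phi> \<in> C"
    and A: "closedin X A" and B: "closedin X B" and AB: "A \<inter> B = {}"
  obtains g where "continuous_on (disc \<Phi>) g" "\<And>v. v \<in> disc \<Phi> \<Longrightarrow> 0 \<le> g v \<and> g v \<le> (1::real)"
    "\<And>v. v \<in> disc_boundary (d \<Phi>) \<Longrightarrow> g v = f (\<Phi> v)"
    "\<And>v. v \<in> disc \<Phi> \<Longrightarrow> \<Phi> v \<in> A \<Longrightarrow> g v = 0" "\<And>v. v \<in> disc \<Phi> \<Longrightarrow> \<Phi> v \<in> B \<Longrightarrow> g v = 1"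
proof -
  let ?bd = "disc_boundary (d \<Phi>)"
  define PA where "PA = disc \<Phi> \<inter> \<Phi> -` A"
  define PB where "PB = disc \<Phi> \<inter> \<Phi> -` B"
  \<comment> \<open>The prescriptions agree on overlaps, as \<open>f\<close> is already 0 on
    \<open>A\<close> and 1 on \<open>B\<close> in the skeleton and \<open>A\<close>,
    \<open>B\<close> are disjoint. The final value 1 is meant for \<open>PB\<close>.\<close>
  define e where "e v = (if v \<in> ?bd then f (\<Phi> v) else if v \<in> PA then 0 else 1)" for v
  have preim: "closed (disc \<Phi> \<inter> \<Phi> -` K)" if "closedin X K" for K
    using weak_topology[of K] that \<Phi> closedin_subset[OF that] by (auto simp: closedin_closed_disc_subset)
  have clAB: "closed PA" "closed PB"
    using preim A B by (auto simp: PA_def PB_def)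
  have bd: "\<Phi> v \<in> below (d \<Phi>)" if "v \<in> ?bd" for v
    using boundary_below[OF \<Phi>] that by blast
  have eA: "e v = 0" if "v \<in> PA" for v
    using f bd that by (auto simp: e_def PA_def partial_Urysohn_def)
  have eB: "e v = 1" if "v \<in> PB" for v
    using f bd that AB by (auto simp: e_def PA_def PB_def partial_Urysohn_def)
  \<comment> \<open>\<open>partial_Urysohn\<close> speaks of discs of smaller dimension only, so
    continuity along this attaching map must be derived: preimages under \<open>f\<close> are closed
    in \<open>X\<close>, and \<open>\<Phi>\<close> pulls them back.\<close>
  have "continuous_on ?bd e"
    unfolding continuous_on_closed_vimage[OF disc_sets_closed(2)]
  proof (intro allI impI)
    fix T :: "real set" assume "closed T"
    then have "closed (disc \<Phi> \<inter> \<Phi> -` {x \<in> below (d \<Phi>). f x \<in> T})"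
      by (rule preim[OF partial_Urysohn_closed_preimage[OF f]])
    then have "closed (?bd \<inter> (disc \<Phi> \<inter> \<Phi> -` {x \<in> below (d \<Phi>). f x \<in> T}))"
      using closed_Int disc_sets_closed(2) by blast
    moreover have "?bd \<inter> (disc \<Phi> \<inter> \<Phi> -` {x \<in> below (d \<Phi>). f x \<in> T}) = e -` T \<inter> ?bd"
      using bd disc_boundary_subset by (auto simp: e_def)
    ultimately show "closed (e -` T \<inter> ?bd)" by simp
  qed
  moreover have "continuous_on PA e" "continuous_on PB e"
    using eA eB by (auto cong: continuous_on_cong)
  ultimately have conte: "continuous_on (?bd \<union> PA \<union> PB) e"
    by (intro continuous_on_closed_Un closed_Un disc_sets_closed clAB)
  have sub: "?bd \<union> PA \<union> PB \<subseteq> disc \<Phi>"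
    using disc_boundary_subset by (auto simp: PA_def PB_def)
  have "e v \<in> {0..1}" if "v \<in> ?bd \<union> PA \<union> PB" for v
    using that f bd by (auto simp: e_def partial_Urysohn_def)
  moreover have "continuous_map (subtopology (top_of_set (disc \<Phi>)) (?bd \<union> PA \<union> PB)) euclideanreal e"
    using conte sub by (simp add: subtopology_subtopology inf.absorb2)
  moreover have "closedin (top_of_set (disc \<Phi>)) (?bd \<union> PA \<union> PB)"
    using sub by (simp add: closedin_closed_disc_subset clAB disc_sets_closed closed_Un)
  ultimately obtain g where "continuous_map (top_of_set (disc \<Phi>)) euclideanreal g"
      "g ` disc \<Phi> \<subseteq> {0..1}" "\<And>v. v \<in> ?bd \<union> PA \<union> PB \<Longrightarrow> g v = e v"
    using Tietze_extension_realinterval[OF normal_space_closed_disc[of "d \<Phi>"], of "?bd \<union> PA \<union> PB" "{0..1}" e]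
    by (auto simp: image_subset_iff)
  then show ?thesis
    using eA eB by (intro that[of g]) (auto simp: e_def PA_def PB_def image_subset_iff)
qed

lemma extend_partial_Urysohn:
  assumes f: "partial_Urysohn A B n f"
    and A: "closedin X A" and B: "closedin X B" and AB: "A \<inter> B = {}"
  shows "\<exists>f'. partial_Urysohn A B (Suc n) f' \<and> (\<forall>x\<in>below n. f' x = f x)"
proof -
  define ext where "ext \<Phi> g \<longleftrightarrow> continuous_on (disc \<Phi>) g \<and>
      (\<forall>v\<in>disc \<Phi>. 0 \<le> g v \<and> g v \<le> (1::real)) \<and>
      (\<forall>v\<in>disc_boundary (d \<Phi>). g v = f (\<Phi> v)) \<and>
      (\<forall>v\<in>disc \<Phi>. (\<Phi> v \<in> A \<longrightarrow> g v = 0) \<and> (\<Phi> v \<in> B \<longrightarrow> g v = 1))" for \<Phi> g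
  have "\<forall>\<Phi>\<in>{\<Phi>\<in>C. d \<Phi> = n}. \<exists>g. ext \<Phi> g"
  proof clarify
    fix \<Phi> assume "\<Phi> \<in> C" "n = d \<Phi>"
    with f have "partial_Urysohn A B (d \<Phi>) f" by simp
    from extend_over_disc[OF this \<open>\<Phi> \<in> C\<close> A B AB] obtain g
      where "continuous_on (disc \<Phi>) g" "\<And>v. v \<in> disc \<Phi> \<Longrightarrow> 0 \<le> g v \<and> g v \<le> (1::real)"
        "\<And>v. v \<in> disc_boundary (d \<Phi>) \<Longrightarrow> g v = f (\<Phi> v)"
        "\<And>v. v \<in> disc \<Phi> \<Longrightarrow> \<Phi> v \<in> A \<Longrightarrow> g v = 0" "\<And>v. v \<in> disc \<Phi> \<Longrightarrow> \<Phi> v \<in> B \<Longrightarrow> g v = 1"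
      by blast
    then have "ext \<Phi> g" by (simp add: ext_def)
    then show "\<exists>g. ext \<Phi> g" by blast
  qed
  then obtain g where "\<forall>\<Phi>\<in>{\<Phi>\<in>C. d \<Phi> = n}. ext \<Phi> (g \<Phi>)"
    by (rule bchoice[THEN exE])
  then have g: "\<And>\<Phi>. \<Phi> \<in> C \<Longrightarrow> d \<Phi> = n \<Longrightarrow> continuous_on (disc \<Phi>) (g \<Phi>)"
    "\<And>\<Phi> v. \<Phi> \<in> C \<Longrightarrow> d \<Phi> = n \<Longrightarrow> v \<in> disc \<Phi> \<Longrightarrow> 0 \<le> g \<Phi> v \<and> g \<Phi> v \<le> (1::real)"
    "\<And>\<Phi> v. \<Phi> \<in> C \<Longrightarrow> d \<Phi> = n \<Longrightarrow> v \<in> disc_boundary (d \<Phi>) \<Longrightarrow> g \<Phi> v = f (\<Phi> v)"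
    "\<And>\<Phi> v. \<Phi> \<in> C \<Longrightarrow> d \<Phi> = n \<Longrightarrow> v \<in> disc \<Phi> \<Longrightarrow> \<Phi> v \<in> A \<Longrightarrow> g \<Phi> v = 0"
    "\<And>\<Phi> v. \<Phi> \<in> C \<Longrightarrow> d \<Phi> = n \<Longrightarrow> v \<in> disc \<Phi> \<Longrightarrow> \<Phi> v \<in> B \<Longrightarrow> g \<Phi> v = 1"
    unfolding ext_def by simp_all
  \<comment> \<open>The description is unambiguous: open cells are disjoint and characteristic maps
    are injective on open discs.\<close>
  define f' where "f' x = (if x \<in> below n then f x
      else (THE r. \<exists>\<Phi>\<in>C. d \<Phi> = n \<and> (\<exists>v\<in>open_disc n. x = \<Phi> v \<and> r = g \<Phi> v)))" for x
  have f'_below: "f' x = f x" if "x \<in> below n" for x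
    using that by (simp add: f'_def)
  have f'_cell: "f' (\<Phi> v) = g \<Phi> v" if \<Phi>: "\<Phi> \<in> C" "d \<Phi> = n" and v: "v \<in> open_disc n" for \<Phi> v
  proof -
    have "(THE r. \<exists>\<Psi>\<in>C. d \<Psi> = n \<and> (\<exists>w\<in>open_disc n. \<Phi> v = \<Psi> w \<and> r = g \<Psi> w)) = g \<Phi> v"
    proof (rule the_equality)
      fix r assume "\<exists>\<Psi>\<in>C. d \<Psi> = n \<and> (\<exists>w\<in>open_disc n. \<Phi> v = \<Psi> w \<and> r = g \<Psi> w)"
      then obtain \<Psi> w where \<Psi>: "\<Psi> \<in> C" "d \<Psi> = n" "w \<in> open_disc n" "\<Phi> v = \<Psi> w" "r = g \<Psi> w"
        by blast
      have "\<Phi> v \<in> cell \<Phi>" "\<Phi> v \<in> cell \<Psi>"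
        using imageI[OF v, of \<Phi>] imageI[OF \<Psi>(3), of \<Psi>] \<Phi>(2) \<Psi>(2,4) by simp_all
      then have "\<Psi> = \<Phi>" using cells_disjoint[OF \<Phi>(1) \<Psi>(1)] by (metis disjoint_iff)
      moreover from this have "w = v"
        using characteristic_inj[of \<Phi>] \<Psi> \<Phi> v by (auto dest: inj_onD)
      ultimately show "r = g \<Phi> v" using \<Psi> by simp
    qed (use that in blast)
    then show ?thesis
      using cell_not_below[of \<Phi> v] that by (simp add: f'_def)
  qed
  have f'_disc: "f' (\<Phi> v) = g \<Phi> v" if \<Phi>: "\<Phi> \<in> C" "d \<Phi> = n" and v: "v \<in> disc \<Phi>" for \<Phi> v
  proof (cases "v \<in> open_disc n")
    case False
    then have "v \<in> disc_boundary (d \<Phi>)" using v \<Phi> by (auto simp: closed_disc_eq)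
    moreover from this have "\<Phi> v \<in> below n" using boundary_below \<Phi> by blast
    ultimately show ?thesis using g(3) \<Phi> f'_below by simp
  qed (use f'_cell that in simp)
  have "continuous_on (disc \<Phi>) (f' \<circ> \<Phi>)" if \<Phi>: "\<Phi> \<in> C" "d \<Phi> < Suc n" for \<Phi>
  proof (cases "d \<Phi> = n")
    case True
    then show ?thesis
      using g(1)[OF \<Phi>(1) True] f'_disc[OF \<Phi>(1) True] by (simp cong: continuous_on_cong)
  next
    case False
    then have "d \<Phi> < n" using \<Phi> by simp
    then have "continuous_on (disc \<Phi>) (f \<circ> \<Phi>)" "\<And>v. v \<in> disc \<Phi> \<Longrightarrow> (f' \<circ> \<Phi>) v = (f \<circ> \<Phi>) v"
      using f \<Phi> f'_below characteristic_image_below[OF \<Phi>(1) \<open>d \<Phi> < n\<close>]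
      by (auto simp: partial_Urysohn_def)
    then show ?thesis by (metis continuous_on_cong)
  qed
  moreover have "0 \<le> f' x \<and> f' x \<le> 1 \<and> (x \<in> A \<longrightarrow> f' x = 0) \<and> (x \<in> B \<longrightarrow> f' x = 1)"
    if "x \<in> below (Suc n)" for x
  proof (cases "x \<in> below n")
    case True
    then show ?thesis using f f'_below by (auto simp: partial_Urysohn_def)
  next
    case False
    with that obtain \<Phi> v where "\<Phi> \<in> C" "d \<Phi> = n" "v \<in> open_disc (d \<Phi>)" "x = \<Phi> v"
      unfolding below_def by (auto simp: less_Suc_eq)
    moreover from this have "v \<in> disc \<Phi>" using open_disc_subset by auto
    ultimately show ?thesis using g(2,4,5) f'_disc by auto
  qed
  ultimately show ?thesis using f'_below by (auto simp: partial_Urysohn_def)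
qed

text \<open>Dependent choice yields stages that keep all earlier values, so every stage reaching
  \<open>x\<close> gives the same \<open>f x\<close>. Continuity is tested disc by disc, and on one
  disc \<open>f\<close> is a single stage.\<close>

lemma Urysohn_function:
  assumes A: "closedin X A" and B: "closedin X B" and AB: "A \<inter> B = {}"
  obtains f where "continuous_map X euclideanreal f" "f ` A \<subseteq> {0}" "f ` B \<subseteq> {1}"
proof -
  have "\<exists>F. \<forall>n. partial_Urysohn A B n (F n) \<and> (\<forall>x\<in>below n. F (Suc n) x = F n x)"
  proof (rule dependent_nat_choice)
    show "\<exists>f. partial_Urysohn A B 0 f" by (simp add: partial_Urysohn_def below_def)
    show "\<exists>f'. partial_Urysohn A B (Suc n) f' \<and> (\<forall>x\<in>below n. f' x = f x)"
      if "partial_Urysohn A B n f" for f n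
      using extend_partial_Urysohn[OF that A B AB] .
  qed
  then obtain F where F: "\<And>n. partial_Urysohn A B n (F n)"
    and F_Suc: "\<And>n x. x \<in> below n \<Longrightarrow> F (Suc n) x = F n x" by blast
  have F_eq: "F m x = F n x" if "n \<le> m" "x \<in> below n" for m n x
    using that
  proof (induction m rule: dec_induct)
    case (step m)
    then show ?case using F_Suc below_mono[of n m] by auto
  qed simp
  define f where "f x = F (LEAST n. x \<in> below n) x" for x
  have f_eq: "f x = F n x" if "x \<in> below n" for x n
    unfolding f_def
    by (rule F_eq[symmetric, OF Least_le[of "\<lambda>n. x \<in> below n", OF that] LeastI[of "\<lambda>n. x \<in> below n", OF that]])
  have top: "\<exists>n. x \<in> below n" if "x \<in> topspace X" for x
  proof -
    have "x \<in> (\<Union>\<Phi>\<in>C. cell \<Phi>)" using that by (simp only: cells_cover)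
    then obtain \<Phi> where "\<Phi> \<in> C" "x \<in> cell \<Phi>" by (rule UN_E)
    then have "x \<in> below (Suc (d \<Phi>))" unfolding below_def by (intro UN_I[of \<Phi>]) simp_all
    then show ?thesis ..
  qed
  have "continuous_map X euclideanreal f"
    unfolding continuous_map_closedin
  proof (intro conjI allI impI funcsetI)
    fix T :: "real set" assume T: "closedin euclideanreal T"
    have "closedin (top_of_set (disc \<Phi>)) (disc \<Phi> \<inter> \<Phi> -` {x \<in> topspace X. f x \<in> T})" if \<Phi>: "\<Phi> \<in> C" for \<Phi>
    proof -
      \<comment> \<open>The stage is one above the dimension because \<open>below\<close> is
        strict.\<close>
      have im: "\<Phi> ` disc \<Phi> \<subseteq> below (Suc (d \<Phi>))"
        using characteristic_image_below[OF \<Phi>] by simp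
      have "continuous_on (disc \<Phi>) (F (Suc (d \<Phi>)) \<circ> \<Phi>)"
        using F[of "Suc (d \<Phi>)"] \<Phi> by (simp add: partial_Urysohn_def)
      then have "closedin (top_of_set (disc \<Phi>)) (disc \<Phi> \<inter> (F (Suc (d \<Phi>)) \<circ> \<Phi>) -` T)"
        using T by (intro continuous_closedin_preimage) auto
      moreover have "disc \<Phi> \<inter> (F (Suc (d \<Phi>)) \<circ> \<Phi>) -` T = disc \<Phi> \<inter> \<Phi> -` {x \<in> topspace X. f x \<in> T}"
        using im below_subset_topspace f_eq by fastforce
      ultimately show ?thesis by simp
    qed
    then show "closedin X {x \<in> topspace X. f x \<in> T}"
      using weak_topology[of "{x \<in> topspace X. f x \<in> T}"] by auto
  qed auto
  moreover have "f x = 0" if "x \<in> A" for x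
  proof -
    obtain n where "x \<in> below n" using top closedin_subset[OF A] \<open>x \<in> A\<close> by blast
    then show ?thesis using f_eq F[of n] that by (auto simp: partial_Urysohn_def)
  qed
  moreover have "f x = 1" if "x \<in> B" for x
  proof -
    obtain n where "x \<in> below n" using top closedin_subset[OF B] \<open>x \<in> B\<close> by blast
    then show ?thesis using f_eq F[of n] that by (auto simp: partial_Urysohn_def)
  qed
  ultimately show ?thesis by (intro that[of f]) auto
qed

lemma normal_space: "normal_space X"
  unfolding normal_space_iff_Urysohn_alt disjnt_def
proof (intro allI impI)
  fix S T assume "closedin X S \<and> closedin X T \<and> S \<inter> T = {}"
  then have "closedin X S" "closedin X T" "S \<inter> T = {}" by auto
  from Urysohn_function[OF this]
  obtain f where "continuous_map X euclideanreal f" "f ` S \<subseteq> {0}" "f ` T \<subseteq> {1}" .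
  then show "\<exists>f. continuous_map X euclideanreal f \<and> f ` S \<subseteq> {0} \<and> f ` T \<subseteq> {1}"
    by blast
qed

end

lemma normal_space_CW_structure: "CW_structure X C d \<Longrightarrow> normal_space X"
  by (rule cw_complex.normal_space) (rule cw_complex.intro)

section \<open>Comparison of the effective invariants\<close>

lemma orbit_of_prod_action:
  "orbit_of (G \<times>\<times> G) (prod_action \<phi>) (x, y) = orbit_of G \<phi> x \<times> orbit_of G \<phi> y"
  by (auto simp: orbit_of_def prod_action_def)

text \<open>A product of sets determines its factors only if these are nonempty; this is how orbit
  equality in the product splits into coordinates.\<close>

lemma orbit_of_nonempty: "group G \<Longrightarrow> orbit_of G \<phi> x \<noteq> {}"
  using group.is_monoid monoid.one_closed by (fastforce simp: orbit_of_def)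

lemma orbit_of_prod_action_eqD:
  assumes "group G" "orbit_of (G \<times>\<times> G) (prod_action \<phi>) p = orbit_of (G \<times>\<times> G) (prod_action \<phi>) q"
  shows "orbit_of G \<phi> (fst p) = orbit_of G \<phi> (fst q)" "orbit_of G \<phi> (snd p) = orbit_of G \<phi> (snd q)"
  using assms(2) orbit_of_nonempty[OF assms(1), of \<phi>]
  by (cases p; cases q; simp add: orbit_of_prod_action times_eq_iff)+

lemma continuous_map_reverse_unit_interval: "continuous_map unit_interval unit_interval (\<lambda>t. 1 - t)"
  by (auto simp: continuous_map_in_subtopology intro!: continuous_intros)

text \<open>The section is only up to homotopy, so its first path need not start at \<open>x0\<close>. The reversed
  first component of the homotopy leads from \<open>x0\<close> to that starting point and is prepended as one
  more path.\<close>
lemma sectional_set_slice: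
  assumes U: "sectional_set (Pk G \<phi> X k) (prod_topology X X) (pi_k k) U"
    and x0: "x0 \<in> topspace X" and k: "1 \<le> k"
  shows "sectional_set (Pk_star G \<phi> X x0 (Suc k)) X (q_k (Suc k)) {x \<in> topspace X. (x0, x) \<in> U}"
proof -
  define V where "V = {x \<in> topspace X. (x0, x) \<in> U}"
  obtain s h where oU: "openin (prod_topology X X) U"
    and s: "continuous_map (subtopology (prod_topology X X) U) (Pk G \<phi> X k) s"
    and h: "continuous_map (prod_topology unit_interval (subtopology (prod_topology X X) U)) (prod_topology X X) h"
    and h0: "\<And>z. z \<in> U \<Longrightarrow> h (0, z) = pi_k k (s z)" and h1: "\<And>z. z \<in> U \<Longrightarrow> h (1, z) = z"
    using U unfolding sectional_set_iff by blast
  have UX: "U \<subseteq> topspace X \<times> topspace X"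
    using openin_subset[OF oU] by simp
  have incl: "continuous_map X (prod_topology X X) (\<lambda>x. (x0, x))"
    using x0 by (simp add: continuous_map_pairwise o_def)
  have oV: "openin X V"
    using openin_continuous_map_preimage[OF incl oU] by (simp add: V_def)
  have tV: "topspace (subtopology X V) = V"
    by (auto simp: V_def)
  have j: "continuous_map (subtopology X V) (subtopology (prod_topology X X) U) (\<lambda>x. (x0, x))"
    unfolding continuous_map_in_subtopology
    using continuous_map_from_subtopology[OF incl] by (auto simp: V_def)
  define p where "p i = (\<lambda>(x, t). if i = 1 then fst (h (1 - t, (x0, x))) else s (x0, x) (i - 1) t)" for i :: nat
  have sP: "s (x0, x) \<in> topspace (Pk G \<phi> X k)" if "x \<in> V" for x
    using continuous_map_image_subset_topspace[OF s] UX that by (auto simp: V_def)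
  have p1: "continuous_map (prod_topology (subtopology X V) unit_interval) X (p 1)"
  proof -
    have "continuous_map (prod_topology (subtopology X V) unit_interval) unit_interval (\<lambda>z. 1 - snd z)"
      using continuous_map_compose[OF continuous_map_snd continuous_map_reverse_unit_interval]
      by (simp add: o_def)
    moreover have "continuous_map (prod_topology (subtopology X V) unit_interval) (subtopology (prod_topology X X) U)
        (\<lambda>z. (x0, fst z))"
      using continuous_map_compose[OF continuous_map_fst j] by (simp add: o_def)
    ultimately have "continuous_map (prod_topology (subtopology X V) unit_interval)
        (prod_topology unit_interval (subtopology (prod_topology X X) U)) (\<lambda>z. (1 - snd z, (x0, fst z)))"
      by (simp add: continuous_map_pairwise o_def)
    from continuous_map_compose[OF continuous_map_compose[OF this h] continuous_map_fst]
    show ?thesis by (simp add: p_def o_def case_prod_unfold)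
  qed
  have pi: "continuous_map (prod_topology (subtopology X V) unit_interval) X (p i)" if i: "i \<in> {1..Suc k}" for i
  proof (cases "i = 1")
    case False
    then have "i - 1 \<in> {1..k}" using i by auto
    note s_comp = continuous_map_Pk_component[OF s this]
    have "continuous_map (prod_topology (subtopology X V) unit_interval)
        (prod_topology (subtopology (prod_topology X X) U) unit_interval) (\<lambda>z. ((x0, fst z), snd z))"
      using continuous_map_compose[OF continuous_map_fst j]
      by (simp add: continuous_map_pairwise o_def continuous_map_snd)
    from continuous_map_compose[OF this s_comp]
    show ?thesis using False by (simp add: p_def o_def case_prod_unfold)
  qed (use p1 in simp)
  have orb: "orbit_of G \<phi> (p i (x, 1)) = orbit_of G \<phi> (p (i + 1) (x, 0))"
    if "x \<in> topspace (subtopology X V)" "1 \<le> i" "i < Suc k" for x i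
  proof (cases "i = 1")
    \<comment> \<open>At the new joint the points coincide: at time 0 the homotopy is at
      \<open>pi_k\<close>, whose first entry is the start of the first path of
      \<open>s\<close>.\<close>
    case True
    then show ?thesis using that h0[of "(x0, x)"] by (simp add: p_def pi_k_def V_def)
  next
    case False
    then show ?thesis
      using that Pk_orbits_match[OF sP, of x "i - 1"] tV by (simp add: p_def)
  qed
  have start: "p 1 (x, 0) = x0" if "x \<in> topspace (subtopology X V)" for x
    using that h1[of "(x0, x)"] by (simp add: p_def V_def)
  let ?S = "\<lambda>x. \<lambda>i\<in>{1..Suc k}. \<lambda>t\<in>{0..1}. p i (x, t)"
  \<comment> \<open>The other component of the same homotopy still links the end point of the broken
    path to \<open>x\<close>.\<close>
  let ?H = "snd \<circ> (h \<circ> (\<lambda>z. (fst z, (x0, snd z))))"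
  have "continuous_map (subtopology X V) (Pk_star G \<phi> X x0 (Suc k)) ?S"
    by (rule continuous_map_into_Pk_star[where h = p, OF pi orb _ start]) auto
  moreover have "continuous_map (prod_topology unit_interval (subtopology X V)) X ?H"
  proof -
    have "continuous_map (prod_topology unit_interval (subtopology X V))
        (prod_topology unit_interval (subtopology (prod_topology X X) U)) (\<lambda>z. (fst z, (x0, snd z)))"
      using continuous_map_compose[OF continuous_map_snd j]
      by (simp add: continuous_map_pairwise o_def continuous_map_fst)
    from continuous_map_compose[OF continuous_map_compose[OF this h] continuous_map_snd]
    show ?thesis .
  qed
  moreover have "?H (0, x) = q_k (Suc k) (?S x)" "?H (1, x) = x" if "x \<in> V" for x
    using that h0[of "(x0, x)"] h1[of "(x0, x)"] k by (simp_all add: V_def q_k_def pi_k_def p_def)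
  ultimately have "sectional_set (Pk_star G \<phi> X x0 (Suc k)) X (q_k (Suc k)) V"
    unfolding sectional_set_iff using oV by blast
  then show ?thesis by (simp add: V_def)
qed

lemma cat_k_Suc_le_TC_k:
  fixes X :: "'a topology"
  assumes "x0 \<in> topspace X" "1 \<le> k"
  shows "cat_k G \<phi> X x0 (Suc k) \<le> TC_k G \<phi> X k"
  unfolding cat_k_def TC_k_def
proof (rule secat_leI)
  fix n and U :: "nat \<Rightarrow> ('a \<times> 'a) set"
  assume cov: "(\<Union>i\<le>n. U i) = topspace (prod_topology X X)"
    and "\<And>i. i \<le> n \<Longrightarrow> sectional_set (Pk G \<phi> X k) (prod_topology X X) (pi_k k) (U i)"
  then show "secat (Pk_star G \<phi> X x0 (Suc k)) X (q_k (Suc k)) \<le> enat n"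
  proof (intro secat_le[where U = "\<lambda>i. {x \<in> topspace X. (x0, x) \<in> U i}"] sectional_set_slice assms)
    have "\<exists>i\<le>n. (x0, x) \<in> U i" if "x \<in> topspace X" for x
    proof -
      have "(x0, x) \<in> (\<Union>i\<le>n. U i)" using that assms(1) by (simp only: cov) simp
      then show ?thesis by auto
    qed
    then show "(\<Union>i\<le>n. {x \<in> topspace X. (x0, x) \<in> U i}) = topspace X" by auto
  qed auto
qed

text \<open>A broken path in \<open>X \<times> X\<close> from \<open>(x0, x0)\<close> to \<open>(x, y)\<close> becomes one from \<open>x\<close> to \<open>y\<close>: traverse the
  first components backwards to \<open>x0\<close>, then the second components forwards.\<close>
lemma sectional_set_unfold_pair:
  assumes G: "group G" and k: "1 \<le> k"
    and U: "sectional_set (Pk_star (G \<times>\<times> G) (prod_action \<phi>) (prod_topology X X) (x0, x0) k)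
              (prod_topology X X) (q_k k) U"
  shows "sectional_set (Pk G \<phi> X (2 * k)) (prod_topology X X) (pi_k (2 * k)) U"
proof -
  let ?XX = "prod_topology X X"
  obtain s h where oU: "openin ?XX U"
    and s: "continuous_map (subtopology ?XX U) (Pk_star (G \<times>\<times> G) (prod_action \<phi>) ?XX (x0, x0) k) s"
    and h: "continuous_map (prod_topology unit_interval (subtopology ?XX U)) ?XX h"
    and h0: "\<And>z. z \<in> U \<Longrightarrow> h (0, z) = q_k k (s z)" and h1: "\<And>z. z \<in> U \<Longrightarrow> h (1, z) = z"
    using U unfolding sectional_set_iff by blast
  have tU: "topspace (subtopology ?XX U) = U"
    using openin_subset[OF oU] by auto
  note sP = continuous_map_Pk_starD[OF s, unfolded tU]
  have orb: "orbit_of G \<phi> (fst (s z i 1)) = orbit_of G \<phi> (fst (s z (i + 1) 0))"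
            "orbit_of G \<phi> (snd (s z i 1)) = orbit_of G \<phi> (snd (s z (i + 1) 0))"
    if "z \<in> U" "1 \<le> i" "i < k" for z i
  proof -
    have "s z \<in> topspace (Pk (G \<times>\<times> G) (prod_action \<phi>) ?XX k)"
      using continuous_map_image_subset_topspace[OF sP(1)] that tU by auto
    from Pk_orbits_match[OF this that(2,3)]
    show "orbit_of G \<phi> (fst (s z i 1)) = orbit_of G \<phi> (fst (s z (i + 1) 0))"
         "orbit_of G \<phi> (snd (s z i 1)) = orbit_of G \<phi> (snd (s z (i + 1) 0))"
      by (auto dest: orbit_of_prod_action_eqD[OF G])
  qed
  \<comment> \<open>\<open>Suc k - i\<close> runs from \<open>k\<close> down to 1: path 1 starts at
    the first coordinate of the given end point, path \<open>k\<close> ends at \<open>x0\<close>,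
    and there path \<open>k + 1\<close> begins.\<close>
  define p where "p i = (\<lambda>(z, t). if i \<le> k then fst (s z (Suc k - i) (1 - t)) else snd (s z (i - k) t))" for i
  have pi: "continuous_map (prod_topology (subtopology ?XX U) unit_interval) X (p i)" if i: "i \<in> {1..2 * k}" for i
  proof (cases "i \<le> k")
    case True
    then have "Suc k - i \<in> {1..k}" using i by auto
    from continuous_map_Pk_component[OF sP(1) this]
    have *: "continuous_map (prod_topology (subtopology ?XX U) unit_interval) ?XX (\<lambda>(z, t). s z (Suc k - i) t)" .
    have "continuous_map (prod_topology (subtopology ?XX U) unit_interval)
        (prod_topology (subtopology ?XX U) unit_interval) (\<lambda>(z, t). (z, 1 - t))"
      unfolding continuous_map_prod_top using continuous_map_reverse_unit_interval by simp
    from continuous_map_compose[OF continuous_map_compose[OF this *] continuous_map_fst]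
    have "continuous_map (prod_topology (subtopology ?XX U) unit_interval) X
        (fst \<circ> ((\<lambda>(z, t). s z (Suc k - i) t) \<circ> (\<lambda>(z, t). (z, 1 - t))))" .
    then show ?thesis using True by (simp add: p_def o_def case_prod_unfold)
  next
    case False
    then have "i - k \<in> {1..k}" using i by auto
    from continuous_map_compose[OF continuous_map_Pk_component[OF sP(1) this] continuous_map_snd]
    show ?thesis using False by (simp add: p_def o_def case_prod_unfold)
  qed
  have orbp: "orbit_of G \<phi> (p i (z, 1)) = orbit_of G \<phi> (p (i + 1) (z, 0))"
    if "z \<in> topspace (subtopology ?XX U)" "1 \<le> i" "i < 2 * k" for z i
  proof -
    have z: "z \<in> U" using that tU by simp
    consider "i < k" | "i = k" | "i > k" by linarith
    then show ?thesis
    proof cases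
      case 1
      then show ?thesis
        using orb(1)[OF z, of "k - i"] that(2) by (simp add: p_def Suc_diff_le)
    next
      case 2
      then show ?thesis using sP(2)[OF z] by (simp add: p_def)
    next
      case 3
      then show ?thesis
        using orb(2)[OF z, of "i - k"] that(3) by (simp add: p_def Suc_diff_le)
    qed
  qed
  let ?S = "\<lambda>x. \<lambda>i\<in>{1..2 * k}. \<lambda>t\<in>{0..1}. p i (x, t)"
  have "continuous_map (subtopology ?XX U) (Pk G \<phi> X (2 * k)) ?S"
    by (rule continuous_map_into_Pk[where h = p, OF pi orbp])
  \<comment> \<open>The two ends of the unfolded path are the two coordinates of the one given end
    point, so \<open>h\<close> serves unchanged.\<close>
  moreover have "h (0, z) = pi_k (2 * k) (?S z)" if "z \<in> U" for z
    using h0[OF that] k by (simp add: pi_k_def q_k_def p_def)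
  ultimately show ?thesis
    unfolding sectional_set_iff using oU h h1 by blast
qed

lemma TC_k_double_le_cat_k:
  fixes X :: "'a topology"
  assumes "group G" "1 \<le> k"
  shows "TC_k G \<phi> X (2 * k) \<le> cat_k (G \<times>\<times> G) (prod_action \<phi>) (prod_topology X X) (x0, x0) k"
  unfolding cat_k_def TC_k_def
proof (rule secat_leI)
  fix n and U :: "nat \<Rightarrow> ('a \<times> 'a) set"
  assume "(\<Union>i\<le>n. U i) = topspace (prod_topology X X)"
    and "\<And>i. i \<le> n \<Longrightarrow> sectional_set (Pk_star (G \<times>\<times> G) (prod_action \<phi>) (prod_topology X X) (x0, x0) k)
              (prod_topology X X) (q_k k) (U i)"
  then show "secat (Pk G \<phi> X (2 * k)) (prod_topology X X) (pi_k (2 * k)) \<le> enat n"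
    by (intro secat_le sectional_set_unfold_pair assms)
qed

section \<open>The product inequality\<close>

lemma sectional_set_Times:
  assumes k: "1 \<le> k"
    and U: "sectional_set (Pk_star G \<phi> X x0 k) X (q_k k) U"
    and V: "sectional_set (Pk_star G \<phi> X x0 k) X (q_k k) V"
  shows "sectional_set (Pk_star (G \<times>\<times> G) (prod_action \<phi>) (prod_topology X X) (x0, x0) k)
           (prod_topology X X) (q_k k) (U \<times> V)"
proof -
  let ?XX = "prod_topology X X" and ?Z = "subtopology (prod_topology X X) (U \<times> V)"
  obtain s h where oU: "openin X U"
    and s: "continuous_map (subtopology X U) (Pk_star G \<phi> X x0 k) s"
    and h: "continuous_map (prod_topology unit_interval (subtopology X U)) X h"
    and h01: "\<And>x. x \<in> U \<Longrightarrow> h (0, x) = q_k k (s x)" "\<And>x. x \<in> U \<Longrightarrow> h (1, x) = x"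
    using U unfolding sectional_set_iff by blast
  obtain r l where oV: "openin X V"
    and r: "continuous_map (subtopology X V) (Pk_star G \<phi> X x0 k) r"
    and l: "continuous_map (prod_topology unit_interval (subtopology X V)) X l"
    and l01: "\<And>x. x \<in> V \<Longrightarrow> l (0, x) = q_k k (r x)" "\<And>x. x \<in> V \<Longrightarrow> l (1, x) = x"
    using V unfolding sectional_set_iff by blast
  have tU: "topspace (subtopology X U) = U" "topspace (subtopology X V) = V"
    using openin_subset[OF oU] openin_subset[OF oV] by auto
  have Z: "?Z = prod_topology (subtopology X U) (subtopology X V)"
    by (simp add: subtopology_Times)
  have tZ: "topspace ?Z = U \<times> V"
    unfolding Z topspace_prod_topology tU ..
  note sP = continuous_map_Pk_starD[OF s, unfolded tU]
  note rP = continuous_map_Pk_starD[OF r, unfolded tU]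
  have fstZ: "continuous_map ?Z (subtopology X U) fst" and sndZ: "continuous_map ?Z (subtopology X V) snd"
    unfolding Z by (rule continuous_map_fst continuous_map_snd)+
  \<comment> \<open>Both broken paths have \<open>k\<close> pieces, so they pair index by index;
    orbits match since an orbit of the product action is a product of orbits.\<close>
  define p where "p i = (\<lambda>((x, y), t). (s x i t, r y i t))" for i
  have pi: "continuous_map (prod_topology ?Z unit_interval) ?XX (p i)" if i: "i \<in> {1..k}" for i
  proof -
    have "continuous_map (prod_topology ?Z unit_interval) X ((\<lambda>(x, t). s x i t) \<circ> (\<lambda>z. (fst (fst z), snd z)))"
      using continuous_map_compose[OF continuous_map_fst fstZ]
      by (intro continuous_map_compose[OF _ continuous_map_Pk_component[OF sP(1) i]])
         (simp add: continuous_map_pairwise o_def continuous_map_snd)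
    moreover have "continuous_map (prod_topology ?Z unit_interval) X ((\<lambda>(x, t). r x i t) \<circ> (\<lambda>z. (snd (fst z), snd z)))"
      using continuous_map_compose[OF continuous_map_fst sndZ]
      by (intro continuous_map_compose[OF _ continuous_map_Pk_component[OF rP(1) i]])
         (simp add: continuous_map_pairwise o_def continuous_map_snd)
    ultimately show ?thesis
      by (simp add: p_def continuous_map_pairwise o_def case_prod_unfold)
  qed
  have orb: "orbit_of (G \<times>\<times> G) (prod_action \<phi>) (p i (z, 1)) = orbit_of (G \<times>\<times> G) (prod_action \<phi>) (p (i + 1) (z, 0))"
    if z: "z \<in> topspace ?Z" and i: "1 \<le> i" "i < k" for z i
  proof -
    obtain x y where xy: "z = (x, y)" "x \<in> U" "y \<in> V" using z tZ by auto
    have P: "s x \<in> topspace (Pk G \<phi> X k)" "r y \<in> topspace (Pk G \<phi> X k)"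
      using continuous_map_image_subset_topspace[OF sP(1)] continuous_map_image_subset_topspace[OF rP(1)] xy tU
      by auto
    show ?thesis
      using Pk_orbits_match[OF P(1) i] Pk_orbits_match[OF P(2) i]
      by (simp add: p_def xy orbit_of_prod_action)
  qed
  have start: "p 1 (z, 0) = (x0, x0)" if "z \<in> topspace ?Z" for z
    using that sP(2) rP(2) unfolding tZ by (auto simp: p_def)
  let ?S = "\<lambda>z. \<lambda>i\<in>{1..k}. \<lambda>t\<in>{0..1}. p i (z, t)"
  let ?H = "\<lambda>(t, z). (h (t, fst z), l (t, snd z))"
  have S: "continuous_map ?Z (Pk_star (G \<times>\<times> G) (prod_action \<phi>) ?XX (x0, x0) k) ?S"
    by (rule continuous_map_into_Pk_star[where h = p, OF pi orb k start])
  have H: "continuous_map (prod_topology unit_interval ?Z) ?XX ?H"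
  proof -
    have "continuous_map (prod_topology unit_interval ?Z) X (h \<circ> (\<lambda>w. (fst w, fst (snd w))))"
      using continuous_map_compose[OF continuous_map_snd fstZ]
      by (intro continuous_map_compose[OF _ h]) (simp add: continuous_map_pairwise o_def continuous_map_fst)
    moreover have "continuous_map (prod_topology unit_interval ?Z) X (l \<circ> (\<lambda>w. (fst w, snd (snd w))))"
      using continuous_map_compose[OF continuous_map_snd sndZ]
      by (intro continuous_map_compose[OF _ l]) (simp add: continuous_map_pairwise o_def continuous_map_fst)
    ultimately show ?thesis
      by (simp add: continuous_map_pairwise o_def case_prod_unfold)
  qed
  have "?H (0, z) = q_k k (?S z)" "?H (1, z) = z" if "z \<in> U \<times> V" for z
    using that h01 l01 k by (auto simp: q_k_def p_def)
  then show ?thesis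
    unfolding sectional_set_iff using S H oU oV by (blast intro: openin_prod_Times_iff[THEN iffD2])
qed

text \<open>Induction on the number of sets, for a general closed \<open>C\<close> because the first
  n sets need only cover \<open>C - U n\<close>. The part \<open>D\<close> of \<open>C\<close> where
  none of their functions is positive is closed and lies in \<open>U n\<close>, so a Urysohn
  function that is 1 on \<open>D\<close> and 0 off \<open>U n\<close> completes the family.\<close>

lemma cozero_refinement:
  assumes X: "normal_space X" and U: "\<And>i. i < n \<Longrightarrow> openin X (U i)"
    and C: "closedin X C" "C \<subseteq> (\<Union>i<n. U i)"
  shows "\<exists>f :: nat \<Rightarrow> 'a \<Rightarrow> real. (\<forall>i<n. continuous_map X euclideanreal (f i) \<and>
            (\<forall>x\<in>topspace X. 0 < f i x \<longrightarrow> x \<in> U i)) \<and> (\<forall>x\<in>C. \<exists>i<n. 0 < f i x)"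
  using U C
proof (induction n arbitrary: C)
  case (Suc n)
  have "closedin X (C - U n)" "C - U n \<subseteq> (\<Union>i<n. U i)"
    using Suc.prems by (auto intro: closedin_diff simp: lessThan_Suc)
  from Suc.IH[OF Suc.prems(1) this]
  obtain f :: "nat \<Rightarrow> 'a \<Rightarrow> real" where "(\<forall>i<n. continuous_map X euclideanreal (f i) \<and>
      (\<forall>x\<in>topspace X. 0 < f i x \<longrightarrow> x \<in> U i)) \<and> (\<forall>x\<in>C - U n. \<exists>i<n. 0 < f i x)"
    by auto
  then have f: "\<And>i. i < n \<Longrightarrow> continuous_map X euclideanreal (f i)"
    "\<And>i x. i < n \<Longrightarrow> x \<in> topspace X \<Longrightarrow> 0 < f i x \<Longrightarrow> x \<in> U i"
    "\<And>x. x \<in> C - U n \<Longrightarrow> \<exists>i<n. 0 < f i x"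
    by simp_all
  define D where "D = C - (\<Union>i<n. {x \<in> topspace X. f i x \<in> {0<..}})"
  have "openin X {x \<in> topspace X. f i x \<in> {0<..}}" if "i < n" for i
    by (rule openin_continuous_map_preimage[OF f(1)[OF that]]) simp
  then have D: "closedin X D"
    unfolding D_def using Suc.prems(2) by (intro closedin_diff openin_clauses(3)) auto
  have CX: "C \<subseteq> topspace X" using Suc.prems(2) by (rule closedin_subset)
  have DU: "D \<subseteq> U n"
    using f(3) CX by (auto simp: D_def)
  have "closedin X (topspace X - U n)" using Suc.prems(1) by blast
  moreover have "disjnt (topspace X - U n) D" using DU by (auto simp: disjnt_def)
  ultimately obtain g :: "'a \<Rightarrow> real" where g: "continuous_map X euclideanreal g"
     "g ` (topspace X - U n) \<subseteq> {0}" "g ` D \<subseteq> {1}"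
    using X D unfolding normal_space_iff_Urysohn_alt by metis
  have "\<exists>i<Suc n. 0 < (f(n := g)) i x" if x: "x \<in> C" for x
  proof (cases "x \<in> D")
    case True
    then have "g x = 1" using g(3) by auto
    then show ?thesis by (intro exI[of _ n]) simp
  next
    case False
    then obtain i where "i < n" "0 < f i x" using x by (auto simp: D_def)
    then show ?thesis by (intro exI[of _ i]) simp
  qed
  moreover have "continuous_map X euclideanreal ((f(n := g)) i) \<and>
      (\<forall>x\<in>topspace X. 0 < (f(n := g)) i x \<longrightarrow> x \<in> U i)" if "i < Suc n" for i
  proof (cases "i = n")
    case True
    have "x \<in> U n" if "x \<in> topspace X" "0 < g x" for x
      using that g(2) by force
    then show ?thesis using True g(1) by simp
  next
    case False
    then show ?thesis using that f(1,2) by simp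
  qed
  ultimately show ?case by blast
qed auto

lemma cat_k_prod_le:
  assumes X: "normal_space X" and k: "1 \<le> k"
  shows "cat_k (G \<times>\<times> G) (prod_action \<phi>) (prod_topology X X) (x0, x0) k \<le> 2 * cat_k G \<phi> X x0 k"
proof (cases "cat_k G \<phi> X x0 k")
  case (enat n)
  let ?XX = "prod_topology X X"
  let ?sect = "sectional_set (Pk_star (G \<times>\<times> G) (prod_action \<phi>) ?XX (x0, x0) k) ?XX (q_k k)"
  obtain U where U: "(\<Union>i\<le>n. U i) = topspace X"
    "\<And>i. i \<le> n \<Longrightarrow> sectional_set (Pk_star G \<phi> X x0 k) X (q_k k) (U i)"
    using secat_enatE[OF enat[unfolded cat_k_def]] by blast
  have "\<And>i. i < Suc n \<Longrightarrow> openin X (U i)" "topspace X \<subseteq> (\<Union>i<Suc n. U i)"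
    using U by (auto simp: sectional_set_def lessThan_Suc_atMost)
  from cozero_refinement[OF X this(1) closedin_topspace this(2)]
  obtain f :: "nat \<Rightarrow> 'a \<Rightarrow> real" where f: "\<And>i. i \<le> n \<Longrightarrow> continuous_map X euclideanreal (f i)"
    "\<And>i x. i \<le> n \<Longrightarrow> x \<in> topspace X \<Longrightarrow> 0 < f i x \<Longrightarrow> x \<in> U i"
    "\<And>x. x \<in> topspace X \<Longrightarrow> \<exists>i\<le>n. 0 < f i x"
    unfolding less_Suc_eq_le by blast
  define J :: "(nat + nat) set" where "J = {..n} <+> {..n}"
  define w where "w p z = (case p of Inl i \<Rightarrow> f i (fst z) | Inr j \<Rightarrow> f j (snd z))" for p :: "nat + nat" and z
  \<comment> \<open>\<open>A R\<close>: the indices in \<open>R\<close> are exactly those whose weight exceeds some threshold. Two such threshold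
      sets at one point are nested, so \<open>A R\<close> and \<open>A S\<close> are disjoint for distinct \<open>R\<close>, \<open>S\<close> of equal size.\<close>
  define A where "A R = {z \<in> topspace ?XX. \<forall>p\<in>R. 0 < w p z \<and> (\<forall>q\<in>J - R. w q z < w p z)}" for R
  \<comment> \<open>both summands have to be met, so the sizes range over \<open>2, \<dots>, 2 * n + 2\<close> only\<close>
  define \<R> where "\<R> m = {R. R \<subseteq> J \<and> (\<exists>i. Inl i \<in> R) \<and> (\<exists>j. Inr j \<in> R) \<and> card R = m + 2}" for m
  have finJ: "finite J" by (simp add: J_def)
  have cardJ: "card J = 2 * n + 2" by (simp add: J_def card_Plus)
  have w: "continuous_map ?XX euclideanreal (w p)" if "p \<in> J" for p
  proof (cases p)
    case (Inl i)
    then have "continuous_map ?XX euclideanreal (f i \<circ> fst)"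
      using that by (intro continuous_map_compose[OF continuous_map_fst] f) (auto simp: J_def)
    then show ?thesis using Inl by (simp add: w_def[abs_def] o_def)
  next
    case (Inr j)
    then have "continuous_map ?XX euclideanreal (f j \<circ> snd)"
      using that by (intro continuous_map_compose[OF continuous_map_snd] f) (auto simp: J_def)
    then show ?thesis using Inr by (simp add: w_def[abs_def] o_def)
  qed
  have openA: "openin ?XX (A R)" if R: "R \<subseteq> J" for R
  proof -
    have fin: "finite R" "finite (J - R)" using R finJ by (auto intro: finite_subset)
    have 1: "openin ?XX {z \<in> topspace ?XX. w p z \<in> {0<..}}" if "p \<in> R" for p
      using that R by (intro openin_continuous_map_preimage[OF w]) auto
    have 2: "openin ?XX {z \<in> topspace ?XX. w p z - w q z \<in> {0<..}}" if "p \<in> R" "q \<in> J - R" for p q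
      using that R by (intro openin_continuous_map_preimage[OF continuous_map_diff[OF w w]]) auto
    \<comment> \<open>Intersecting with the whole space takes care of empty index sets, such as
      \<open>J - R\<close> when \<open>R = J\<close>.\<close>
    have "A R = (\<Inter>p\<in>R. ({z \<in> topspace ?XX. w p z \<in> {0<..}} \<inter>
        ((\<Inter>q\<in>J - R. {z \<in> topspace ?XX. w p z - w q z \<in> {0<..}}) \<inter> topspace ?XX))) \<inter> topspace ?XX"
      unfolding A_def by auto
    also have "openin ?XX \<dots>"
      by (intro openin_INT openin_Int fin 1 2)
    finally show ?thesis .
  qed
  have secA: "?sect (A R)" if R: "R \<in> \<R> m" for R m
  proof -
    obtain i j where ij: "Inl i \<in> R" "Inr j \<in> R" "R \<subseteq> J"
      using R by (auto simp: \<R>_def)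
    then have le: "i \<le> n" "j \<le> n" by (auto simp: J_def)
    have "A R \<subseteq> U i \<times> U j"
    proof clarify
      fix x y assume "(x, y) \<in> A R"
      then have "0 < w (Inl i) (x, y)" "0 < w (Inr j) (x, y)" "x \<in> topspace X" "y \<in> topspace X"
        using ij by (auto simp: A_def)
      then show "x \<in> U i \<and> y \<in> U j" using f(2) le by (simp add: w_def)
    qed
    moreover have "?sect (U i \<times> U j)"
      by (intro sectional_set_Times k U le)
    ultimately show ?thesis
      using openA[OF ij(3)] by (blast intro: sectional_set_subset)
  qed
  have disj: "A R \<inter> A S = {}" if R: "R \<in> \<R> m" "S \<in> \<R> m" "R \<noteq> S" for R S m
  proof -
    have fin: "finite R" "finite S" and card: "card R = card S" and sub: "R \<subseteq> J" "S \<subseteq> J"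
      using R finJ by (auto simp: \<R>_def intro: finite_subset)
    have "\<not> R \<subseteq> S" "\<not> S \<subseteq> R"
      using card_subset_eq[OF fin(2)] card_subset_eq[OF fin(1)] card R(3) by auto
    \<comment> \<open>Membership in \<open>A R\<close> and in \<open>A S\<close> would order the
      weights of \<open>p\<close> and \<open>q\<close> in opposite ways.\<close>
    then obtain p q where "p \<in> R - S" "q \<in> S - R" by blast
    then have "w q z < w p z" "w p z < w q z" if "z \<in> A R" "z \<in> A S" for z
      using that sub unfolding A_def by blast+
    then show ?thesis by fastforce
  qed
  have cover: "(\<Union>m\<le>2 * n. \<Union>R\<in>\<R> m. A R) = topspace ?XX"
  proof (intro equalityI subsetI)
    fix z assume z: "z \<in> topspace ?XX"
    then obtain i j where ij: "i \<le> n" "0 < f i (fst z)" "j \<le> n" "0 < f j (snd z)"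
      using f(3)[of "fst z"] f(3)[of "snd z"] by auto
    define t where "t = min (f i (fst z)) (f j (snd z))"
    define R where "R = {p \<in> J. t \<le> w p z}"
    have "0 < t" using ij by (simp add: t_def)
    then have zA: "z \<in> A R" using z by (auto simp: A_def R_def)
    have RJ: "R \<subseteq> J" by (auto simp: R_def)
    have mem: "Inl i \<in> R" "Inr j \<in> R" using ij by (auto simp: R_def J_def w_def t_def)
    \<comment> \<open>Two distinct members make the truncated subtraction \<open>card R - 2\<close>
      exact.\<close>
    have "card {Inl i, Inr j :: nat + nat} \<le> card R"
      using mem RJ finJ by (intro card_mono) (auto intro: finite_subset)
    then have "2 \<le> card R" by simp
    moreover have "card R \<le> 2 * n + 2"
      using card_mono[OF finJ RJ] cardJ by simp
    ultimately have "R \<in> \<R> (card R - 2)" "card R - 2 \<le> 2 * n"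
      using mem RJ by (auto simp: \<R>_def)
    then show "z \<in> (\<Union>m\<le>2 * n. \<Union>R\<in>\<R> m. A R)" using zA by blast
  qed (auto simp: A_def)
  have "cat_k (G \<times>\<times> G) (prod_action \<phi>) ?XX (x0, x0) k \<le> enat (2 * n)"
    unfolding cat_k_def using cover
    by (rule secat_le) (rule sectional_set_disjoint_Union[OF secA disj])
  then show ?thesis
    by (simp add: enat numeral_eq_enat)
next
  case infinity
  have "2 * (\<infinity> :: enat) = \<infinity>" by (simp add: imult_is_infinity)
  then show ?thesis using infinity by simp
qed

theorem mainTheorem4:
  fixes G :: "('g, 'm) monoid_scheme" and TG :: "'g topology"
    and \<phi> :: "'g \<Rightarrow> 'a \<Rightarrow> 'a" and X :: "'a topology" and x0 :: 'a
  assumes "G_space G TG \<phi> X"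
    and "cellular_G_CW_complex G \<phi> X"
    and "x0 \<in> topspace X"
  shows "cat_inf G \<phi> X x0 \<le> TC_inf G \<phi> X
       \<and> TC_inf G \<phi> X \<le> cat_inf (G \<times>\<times> G) (prod_action \<phi>) (prod_topology X X) (x0, x0)
       \<and> cat_inf (G \<times>\<times> G) (prod_action \<phi>) (prod_topology X X) (x0, x0) \<le> 2 * cat_inf G \<phi> X x0"
proof (intro conjI)
  let ?catXX = "cat_k (G \<times>\<times> G) (prod_action \<phi>) (prod_topology X X) (x0, x0)"
  have G: "group G"
    using assms(1) by (simp add: G_space_def topological_group_def)
  have X: "normal_space X"
    using assms(2) normal_space_CW_structure unfolding cellular_G_CW_complex_def by blast
  show "cat_inf G \<phi> X x0 \<le> TC_inf G \<phi> X"
    unfolding cat_inf_def TC_inf_def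
  proof (rule INF_greatest)
    fix k :: nat assume "k \<in> {1..}"
    then show "(INF k\<in>{1..}. cat_k G \<phi> X x0 k) \<le> TC_k G \<phi> X k"
      using cat_k_Suc_le_TC_k[OF assms(3)] by (intro INF_lower2[of "Suc k"]) auto
  qed
  show "TC_inf G \<phi> X \<le> cat_inf (G \<times>\<times> G) (prod_action \<phi>) (prod_topology X X) (x0, x0)"
    unfolding cat_inf_def TC_inf_def
  proof (rule INF_greatest)
    fix k :: nat assume "k \<in> {1..}"
    then show "(INF k\<in>{1..}. TC_k G \<phi> X k) \<le> ?catXX k"
      using TC_k_double_le_cat_k[OF G] by (intro INF_lower2[of "2 * k"]) auto
  qed
  \<comment> \<open>A \<open>k\<close> attaining the minimum is fixed, and the product inequality is
    applied for this \<open>k\<close> alone.\<close>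
  have "(INF k\<in>{1..}. cat_k G \<phi> X x0 k) \<in> cat_k G \<phi> X x0 ` {1..}"
    by (rule enat_Inf_in) auto
  then obtain k where k: "1 \<le> k" "cat_inf G \<phi> X x0 = cat_k G \<phi> X x0 k"
    unfolding cat_inf_def by auto
  have "cat_inf (G \<times>\<times> G) (prod_action \<phi>) (prod_topology X X) (x0, x0) \<le> ?catXX k"
    unfolding cat_inf_def using k(1) by (intro INF_lower) auto
  also have "\<dots> \<le> 2 * cat_inf G \<phi> X x0"
    unfolding k(2) by (rule cat_k_prod_le[OF X k(1)])
  finally show "cat_inf (G \<times>\<times> G) (prod_action \<phi>) (prod_topology X X) (x0, x0) \<le> 2 * cat_inf G \<phi> X x0" .
qed

end
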